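(* Let $d\ge1$ and $\varepsilon>0$. If $u\in H^1(\mathcal G^d_\varepsilon)$, then $\hat u\in H^1(\mathbb V^d_\varepsilon)$ and $$\|\nabla^d_\varepsilon\hat u\|^2_{\ell^2(\mathbb V^d_\varepsilon)}\le\|u'\|^2_{L^2(\mathcal G^d_\varepsilon)} .$$ In addition, if $f\in H^1(\mathbb V^d_\varepsilon)$, then $\tilde f\in H^1(\mathcal G^d_\varepsilon)$ and $$\|\tilde f'\|^2_{L^2(\mathcal G^d_\varepsilon)}=\|\nabla^d_\varepsilon f\|^2_{\ell^2(\mathbb V^d_\varepsilon)} .$$
   Context: Lattice graph: $\mathbb V^d_\varepsilon=\varepsilon\mathbb Z^d$, $x\sim y$ iff $\sum_{i=1}^d|x_i-y_i|=\varepsilon$; $\|\nabla^d_\varepsilon f\|^2_{\ell^2(\mathbb V^d_\varepsilon)}=\frac1{2\varepsilon}\sum_{x\in\mathbb V^d_\varepsilon}\sum_{y\sim x}|f(y)-f(x)|^2$. $H^1(\mathbb V^d_\varepsilon)$ is the completion of the finitely supported real functions under $(\|\nabla^d_\varepsilon f\|^2_{\ell^2}+\|f\|^2_{\ell^2})^{1/2}$ ($\ell^2$ with counting measure). Metric grid: $\mathcal G^d_\varepsilon$ is the metric graph (subset of $\mathbb R^d$) with vertex set $\varepsilon\mathbb Z^d$ and an edge, identified with the interval $[0,\varepsilon]$, between every two vertices at distance $\varepsilon$. $L^2(\mathcal G^d_\varepsilon)$ is with respect to one-dimensional Lebesgue measure on the edges. $H^1(\mathcal G^d_\varepsilon)$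 is the space of continuous $u:\mathcal G^d_\varepsilon\to\mathbb R$ whose restriction to every edge is in $H^1([0,\varepsilon])$ and with $\|u'\|^2_{L^2(\mathcal G^d_\varepsilon)}+\|u\|^2_{L^2(\mathcal G^d_\varepsilon)}<\infty$. For $u\in H^1(\mathcal G^d_\varepsilon)$, $\hat u=u|_{\mathbb V^d_\varepsilon}$. For $f\in H^1(\mathbb V^d_\varepsilon)$, $\tilde f:\mathcal G^d_\varepsilon\to\mathbb R$ is the function equal to $f$ at the vertices and affine on every edge. *)

theory Defs
  imports "HOL-Analysis.Analysis"
begin

text \<open>The dimension is \<open>d = CARD('n)\<close>. Functions on a subset of \<open>real ^ 'n\<close> are total functions
  whose values outside that subset play no role. All squared norms take values in \<^typ>\<open>ennreal\<close>,
  so that a divergent sum or integral has the value \<open>\<infinity>\<close>.\<close>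

definition L2_sqnorm :: "'a measure \<Rightarrow> ('a \<Rightarrow> real) \<Rightarrow> ennreal" where
  "L2_sqnorm M f = (\<integral>\<^sup>+ x. ennreal ((f x)\<^sup>2) \<partial>M)"

definition L2_space :: "'a measure \<Rightarrow> ('a \<Rightarrow> real) set" where
  "L2_space M = {f \<in> borel_measurable M. L2_sqnorm M f < \<infinity>}"


subsection \<open>The Sobolev space on an interval\<close>

text \<open>Test functions for the weak derivative: \<open>C\<^sup>1\<close> with compact support in the open interval.
  (In one dimension, \<open>C\<^sup>1\<close> and smooth test functions give the same space and the same weak
  derivative.)\<close>

definition test_function :: "real \<Rightarrow> real \<Rightarrow> (real \<Rightarrow> real) \<Rightarrow> bool" where
  "test_function a b \<phi> \<longleftrightarrow> \<phi> C1_differentiable_on UNIV \<and>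
     (\<exists>K. compact K \<and> K \<subseteq> {a<..<b} \<and> (\<forall>x. x \<notin> K \<longrightarrow> \<phi> x = 0))"

definition is_weak_deriv :: "real \<Rightarrow> real \<Rightarrow> (real \<Rightarrow> real) \<Rightarrow> (real \<Rightarrow> real) \<Rightarrow> bool" where
  "is_weak_deriv a b v w \<longleftrightarrow> (\<forall>\<phi>. test_function a b \<phi> \<longrightarrow>
     (\<integral>x. v x * deriv \<phi> x \<partial>lebesgue_on {a..b}) = - (\<integral>x. w x * \<phi> x \<partial>lebesgue_on {a..b}))"

definition H1_interval :: "real \<Rightarrow> real \<Rightarrow> (real \<Rightarrow> real) set" where
  "H1_interval a b = {v \<in> L2_space (lebesgue_on {a..b}).
     \<exists>w \<in> L2_space (lebesgue_on {a..b}). is_weak_deriv a b v w}"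

text \<open>A representative; the weak derivative is unique only almost everywhere.\<close>

definition weak_deriv :: "real \<Rightarrow> real \<Rightarrow> (real \<Rightarrow> real) \<Rightarrow> real \<Rightarrow> real" where
  "weak_deriv a b v = (SOME w. w \<in> L2_space (lebesgue_on {a..b}) \<and> is_weak_deriv a b v w)"


subsection \<open>The lattice graph\<close>

definition lattice :: "real \<Rightarrow> (real ^ 'n) set" where
  "lattice \<epsilon> = {x. \<forall>i. \<exists>k::int. x $ i = \<epsilon> * of_int k}"

definition lattice_adj :: "real \<Rightarrow> real ^ 'n \<Rightarrow> real ^ 'n \<Rightarrow> bool" where
  "lattice_adj \<epsilon> x y \<longleftrightarrow> x \<in> lattice \<epsilon> \<and> y \<in> lattice \<epsilon> \<and> (\<Sum>i\<in>UNIV. \<bar>x $ i - y $ i\<bar>) = \<epsilon>"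

definition grad_sqnorm :: "real \<Rightarrow> (real ^ 'n \<Rightarrow> real) \<Rightarrow> ennreal" where
  "grad_sqnorm \<epsilon> f = ennreal (1 / (2 * \<epsilon>)) *
     (\<integral>\<^sup>+ x. ennreal (\<Sum>y | lattice_adj \<epsilon> x y. \<bar>f y - f x\<bar>\<^sup>2) \<partial>count_space (lattice \<epsilon>))"

definition lattice_H1_sqnorm :: "real \<Rightarrow> (real ^ 'n \<Rightarrow> real) \<Rightarrow> ennreal" where
  "lattice_H1_sqnorm \<epsilon> f = grad_sqnorm \<epsilon> f + L2_sqnorm (count_space (lattice \<epsilon>)) f"

text \<open>The completion of the finitely supported functions, realised as a space of functions: the
  class of a Cauchy sequence is identified with its pointwise limit. This is legitimate because the
  norm dominates the \<open>\<ell>\<^sup>2\<close> norm and is bounded by a multiple of it: Cauchy sequences converge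
  pointwise, and two of them have the same limit iff their difference tends to \<open>0\<close> in norm.\<close>

definition H1_lattice :: "real \<Rightarrow> (real ^ 'n \<Rightarrow> real) set" where
  "H1_lattice \<epsilon> = {f. \<exists>F :: nat \<Rightarrow> real ^ 'n \<Rightarrow> real.
     (\<forall>n. finite {x \<in> lattice \<epsilon>. F n x \<noteq> 0}) \<and>
     (\<forall>\<delta>>0. \<exists>N. \<forall>m\<ge>N. \<forall>n\<ge>N. lattice_H1_sqnorm \<epsilon> (\<lambda>x. F m x - F n x) < ennreal (\<delta>\<^sup>2)) \<and>
     (\<forall>x \<in> lattice \<epsilon>. (\<lambda>n. F n x) \<longlonglongrightarrow> f x)}"


subsection \<open>The metric grid\<close>

text \<open>Adjacent vertices differ in exactly one coordinate, so the componentwise order selects exactly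
  one orientation of every undirected edge.\<close>

definition grid_edges :: "real \<Rightarrow> ((real ^ 'n) \<times> (real ^ 'n)) set" where
  "grid_edges \<epsilon> = {(x, y). lattice_adj \<epsilon> x y \<and> x \<le> y}"

text \<open>The arc-length parametrisation of an edge by \<open>[0, \<epsilon>]\<close>.\<close>

definition edge_point :: "real \<Rightarrow> (real ^ 'n) \<times> (real ^ 'n) \<Rightarrow> real \<Rightarrow> real ^ 'n" where
  "edge_point \<epsilon> e s = fst e + (s / \<epsilon>) *\<^sub>R (snd e - fst e)"

definition metric_grid :: "real \<Rightarrow> (real ^ 'n) set" where
  "metric_grid \<epsilon> = (\<Union>e \<in> grid_edges \<epsilon>. edge_point \<epsilon> e ` {0..\<epsilon>})"

definition edge_fun :: "real \<Rightarrow> (real ^ 'n \<Rightarrow> real) \<Rightarrow> (real ^ 'n) \<times> (real ^ 'n) \<Rightarrow> real \<Rightarrow> real" where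
  "edge_fun \<epsilon> u e = (\<lambda>s. u (edge_point \<epsilon> e s))"

definition grid_sqnorm :: "real \<Rightarrow> (real ^ 'n \<Rightarrow> real) \<Rightarrow> ennreal" where
  "grid_sqnorm \<epsilon> u =
     (\<integral>\<^sup>+ e. L2_sqnorm (lebesgue_on {0..\<epsilon>}) (edge_fun \<epsilon> u e) \<partial>count_space (grid_edges \<epsilon>))"

definition grid_deriv_sqnorm :: "real \<Rightarrow> (real ^ 'n \<Rightarrow> real) \<Rightarrow> ennreal" where
  "grid_deriv_sqnorm \<epsilon> u =
     (\<integral>\<^sup>+ e. L2_sqnorm (lebesgue_on {0..\<epsilon>}) (weak_deriv 0 \<epsilon> (edge_fun \<epsilon> u e))
        \<partial>count_space (grid_edges \<epsilon>))"

definition H1_grid :: "real \<Rightarrow> (real ^ 'n \<Rightarrow> real) set" where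
  "H1_grid \<epsilon> = {u. continuous_on (metric_grid \<epsilon>) u \<and>
     (\<forall>e \<in> grid_edges \<epsilon>. edge_fun \<epsilon> u e \<in> H1_interval 0 \<epsilon>) \<and>
     grid_deriv_sqnorm \<epsilon> u + grid_sqnorm \<epsilon> u < \<infinity>}"


subsection \<open>Restriction to the vertices and affine extension\<close>

definition vertex_restriction :: "real \<Rightarrow> (real ^ 'n \<Rightarrow> real) \<Rightarrow> real ^ 'n \<Rightarrow> real" where
  "vertex_restriction \<epsilon> u = restrict u (lattice \<epsilon>)"

definition is_affine_extension ::
    "real \<Rightarrow> (real ^ 'n \<Rightarrow> real) \<Rightarrow> (real ^ 'n \<Rightarrow> real) \<Rightarrow> bool" where
  "is_affine_extension \<epsilon> f g \<longleftrightarrow> (\<forall>x \<in> lattice \<epsilon>. g x = f x) \<and>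
     (\<forall>e \<in> grid_edges \<epsilon>. \<exists>a b. \<forall>s \<in> {0..\<epsilon>}. g (edge_point \<epsilon> e s) = a + b * s)"

definition affine_extension :: "real \<Rightarrow> (real ^ 'n \<Rightarrow> real) \<Rightarrow> real ^ 'n \<Rightarrow> real" where
  "affine_extension \<epsilon> f =
     (THE g. g \<in> extensional (metric_grid \<epsilon>) \<and> is_affine_extension \<epsilon> f g)"

lemma lattice_adj_imp_axis:
  fixes x y :: "real ^ 'n"
  assumes "\<epsilon> > 0" "lattice_adj \<epsilon> x y"
  shows "\<exists>i. y = x + \<epsilon> *\<^sub>R axis i 1 \<or> y = x - \<epsilon> *\<^sub>R axis i 1"
proof -
  from assms(2) obtain p q :: "'n \<Rightarrow> int" where
    p: "\<And>i. x $ i = \<epsilon> * of_int (p i)" and q: "\<And>i. y $ i = \<epsilon> * of_int (q i)" and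
    s: "(\<Sum>i\<in>UNIV. \<bar>x $ i - y $ i\<bar>) = \<epsilon>"
    unfolding lattice_adj_def lattice_def mem_Collect_eq by metis
  have "\<bar>x $ i - y $ i\<bar> = \<epsilon> * of_int \<bar>p i - q i\<bar>" for i
    using assms(1) by (simp add: p q abs_mult flip: right_diff_distrib)
  then have "\<epsilon> * of_int (\<Sum>i\<in>UNIV. \<bar>p i - q i\<bar>) = \<epsilon> * 1"
    using s by (simp add: sum_distrib_left)
  then have 1: "(\<Sum>i\<in>UNIV. \<bar>p i - q i\<bar>) = 1"
    using assms(1) by (metis mult_cancel_left of_int_eq_1_iff order_less_irrefl)
  then obtain i where i: "p i \<noteq> q i"
    by (metis (no_types, lifting) abs_0 diff_self sum.neutral zero_neq_one)
  have 2: "(\<Sum>j\<in>UNIV. \<bar>p j - q j\<bar>) = \<bar>p i - q i\<bar> + (\<Sum>j\<in>UNIV - {i}. \<bar>p j - q j\<bar>)"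
    by (simp add: sum.remove)
  have 3: "(\<Sum>j\<in>UNIV - {i}. \<bar>p j - q j\<bar>) \<ge> 0" by (simp add: sum_nonneg)
  have 4: "(\<Sum>j\<in>UNIV - {i}. \<bar>p j - q j\<bar>) = 0" and 5: "\<bar>p i - q i\<bar> = 1"
    using 1 2 3 i by linarith+
  have 6: "p j = q j" if "j \<noteq> i" for j
    using 4 that by (subst (asm) sum_nonneg_eq_0_iff) auto
  show ?thesis
  proof (cases "q i = p i + 1")
    case True
    then have "y = x + \<epsilon> *\<^sub>R axis i 1"
      using 6 by (auto simp: vec_eq_iff p q axis_def distrib_left)
    then show ?thesis by blast
  next
    case False
    then have "q i = p i - 1" using 5 by linarith
    then have "y = x - \<epsilon> *\<^sub>R axis i 1"
      using 6 by (auto simp: vec_eq_iff p q axis_def right_diff_distrib)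
    then show ?thesis by blast
  qed
qed

lemma finite_lattice_neighbours:
  fixes x :: "real ^ 'n"
  assumes "\<epsilon> > 0"
  shows "finite {y. lattice_adj \<epsilon> x y}"
proof (rule finite_subset)
  show "{y. lattice_adj \<epsilon> x y} \<subseteq>
      range (\<lambda>i. x + \<epsilon> *\<^sub>R axis i 1) \<union> range (\<lambda>i. x - \<epsilon> *\<^sub>R axis i 1)"
    using lattice_adj_imp_axis[OF assms] by fastforce
qed simp

lemma grid_edges_eq:
  fixes x y :: "real ^ 'n"
  assumes "\<epsilon> > 0"
  shows "(x, y) \<in> grid_edges \<epsilon> \<longleftrightarrow> x \<in> lattice \<epsilon> \<and> (\<exists>i. y = x + \<epsilon> *\<^sub>R axis i 1)"
proof
  assume e: "(x, y) \<in> grid_edges \<epsilon>"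
  then obtain i where "y = x + \<epsilon> *\<^sub>R axis i 1 \<or> y = x - \<epsilon> *\<^sub>R axis i 1"
    using lattice_adj_imp_axis[OF assms] unfolding grid_edges_def by blast
  moreover have "y \<noteq> x - \<epsilon> *\<^sub>R axis i 1"
  proof
    assume "y = x - \<epsilon> *\<^sub>R axis i 1"
    then have "y $ i = x $ i - \<epsilon>" by (simp add: axis_def)
    moreover have "x $ i \<le> y $ i" using e by (simp add: grid_edges_def less_eq_vec_def)
    ultimately show False using assms by simp
  qed
  ultimately show "x \<in> lattice \<epsilon> \<and> (\<exists>i. y = x + \<epsilon> *\<^sub>R axis i 1)"
    using e by (auto simp: grid_edges_def lattice_adj_def)
next
  assume "x \<in> lattice \<epsilon> \<and> (\<exists>i. y = x + \<epsilon> *\<^sub>R axis i 1)"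
  then obtain i where x: "x \<in> lattice \<epsilon>" and y: "y = x + \<epsilon> *\<^sub>R axis i 1" by blast
  have "\<exists>k::int. y $ j = \<epsilon> * of_int k" for j
  proof -
    obtain k :: int where "x $ j = \<epsilon> * of_int k" using x by (auto simp: lattice_def)
    then have "y $ j = \<epsilon> * of_int (if j = i then k + 1 else k)"
      by (auto simp: y axis_def distrib_left)
    then show ?thesis by blast
  qed
  then have "y \<in> lattice \<epsilon>" by (simp add: lattice_def)
  moreover have "\<bar>x $ j - y $ j\<bar> = (if j = i then \<epsilon> else 0)" for j
    using assms by (auto simp: y axis_def)
  moreover have "x \<le> y" using assms by (auto simp: y less_eq_vec_def axis_def)
  ultimately show "(x, y) \<in> grid_edges \<epsilon>"
    using x by (simp add: grid_edges_def lattice_adj_def)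
qed

lemma lattice_subset_metric_grid:
  assumes "\<epsilon> > 0"
  shows "lattice \<epsilon> \<subseteq> (metric_grid \<epsilon> :: (real ^ 'n) set)"
proof
  fix x :: "real ^ 'n" assume "x \<in> lattice \<epsilon>"
  then have "(x, x + \<epsilon> *\<^sub>R axis undefined 1) \<in> grid_edges \<epsilon>"
    using assms by (auto simp: grid_edges_eq)
  moreover have "x = edge_point \<epsilon> (x, x + \<epsilon> *\<^sub>R axis undefined 1) 0"
    by (simp add: edge_point_def)
  ultimately show "x \<in> metric_grid \<epsilon>"
    using assms unfolding metric_grid_def by (metis (no_types, lifting) UN_I atLeastAtMost_iff
        image_eqI less_eq_real_def)
qed

lemma affine_extension_ex1:
  fixes f :: "real ^ 'n \<Rightarrow> real"
  assumes "\<epsilon> > 0"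
  shows "\<exists>!g. g \<in> extensional (metric_grid \<epsilon>) \<and> is_affine_extension \<epsilon> f g"
proof (rule ex_ex1I)
  define base :: "real ^ 'n \<Rightarrow> real ^ 'n" where "base = (\<lambda>z. \<chi> i. \<epsilon> * of_int \<lfloor>z $ i / \<epsilon>\<rfloor>)"
  define G where "G = (\<lambda>z. f (base z) +
    (\<Sum>i\<in>UNIV. frac (z $ i / \<epsilon>) * (f (base z + \<epsilon> *\<^sub>R axis i 1) - f (base z))))"
  have G_vertex: "G x = f x" if x: "x \<in> lattice \<epsilon>" for x
  proof -
    obtain k :: "'n \<Rightarrow> int" where k: "\<And>i. x $ i = \<epsilon> * of_int (k i)"
      using x unfolding lattice_def mem_Collect_eq by metis
    have "base x = x" using assms by (simp add: base_def vec_eq_iff k)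
    then show ?thesis using assms by (simp add: G_def k)
  qed
  have G_edge: "G (edge_point \<epsilon> (x, y) s) = f x + (f y - f x) / \<epsilon> * s"
    if e: "(x, y) \<in> grid_edges \<epsilon>" and s: "s \<in> {0..\<epsilon>}" for x y s
  proof (cases "s = \<epsilon>")
    case True
    have "edge_point \<epsilon> (x, y) s = y" using True assms by (simp add: edge_point_def)
    moreover have "y \<in> lattice \<epsilon>" using e by (simp add: grid_edges_def lattice_adj_def)
    ultimately show ?thesis using G_vertex True assms by simp
  next
    case False
    with s assms have t: "0 \<le> s / \<epsilon>" "s / \<epsilon> < 1" by auto
    obtain i where x: "x \<in> lattice \<epsilon>" and y: "y = x + \<epsilon> *\<^sub>R axis i 1"
      using e assms by (auto simp: grid_edges_eq)
    obtain k :: "'n \<Rightarrow> int" where k: "\<And>j. x $ j = \<epsilon> * of_int (k j)"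
      using x unfolding lattice_def mem_Collect_eq by metis
    define z where "z = edge_point \<epsilon> (x, y) s"
    have zj: "z $ j / \<epsilon> = of_int (k j) + (if j = i then s / \<epsilon> else 0)" for j
      using assms by (simp add: z_def edge_point_def y k axis_def field_simps)
    have fl: "\<lfloor>z $ j / \<epsilon>\<rfloor> = k j" for j
      unfolding zj using t by (intro floor_unique) auto
    have fr: "frac (z $ j / \<epsilon>) = (if j = i then s / \<epsilon> else 0)" for j
      unfolding frac_def fl using zj[of j] by simp
    have "base z = x" by (simp add: base_def fl vec_eq_iff k)
    then have "G z = f x + s / \<epsilon> * (f y - f x)"
      by (simp add: G_def fr y if_distrib[of "\<lambda>t. t * _"] sum.delta cong: if_cong)
    then show ?thesis by (simp add: z_def)
  qed
  have mem: "edge_point \<epsilon> e s \<in> metric_grid \<epsilon>" if "e \<in> grid_edges \<epsilon>" "s \<in> {0..\<epsilon>}"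
    for e :: "(real ^ 'n) \<times> (real ^ 'n)" and s
    using that unfolding metric_grid_def by blast
  have "is_affine_extension \<epsilon> f (restrict G (metric_grid \<epsilon>))"
    unfolding is_affine_extension_def
  proof (intro conjI ballI)
    fix x :: "real ^ 'n" assume "x \<in> lattice \<epsilon>"
    then show "restrict G (metric_grid \<epsilon>) x = f x"
      using lattice_subset_metric_grid[OF assms] G_vertex by (auto simp: restrict_def)
  next
    fix e :: "(real ^ 'n) \<times> (real ^ 'n)" assume e: "e \<in> grid_edges \<epsilon>"
    obtain x y where xy: "e = (x, y)" by (cases e)
    have "\<forall>s\<in>{0..\<epsilon>}. restrict G (metric_grid \<epsilon>) (edge_point \<epsilon> e s) =
        f x + (f y - f x) / \<epsilon> * s"
      using G_edge mem e xy by auto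
    then show "\<exists>a b. \<forall>s\<in>{0..\<epsilon>}. restrict G (metric_grid \<epsilon>) (edge_point \<epsilon> e s) = a + b * s"
      by blast
  qed
  then show "\<exists>g. g \<in> extensional (metric_grid \<epsilon>) \<and> is_affine_extension \<epsilon> f g"
    by blast
next
  have val: "g (edge_point \<epsilon> e s) = f (fst e) + (f (snd e) - f (fst e)) / \<epsilon> * s"
    if g: "is_affine_extension \<epsilon> f g" and e: "e \<in> grid_edges \<epsilon>" and s: "s \<in> {0..\<epsilon>}" for g e s
  proof -
    obtain a b where ab: "\<forall>s\<in>{0..\<epsilon>}. g (edge_point \<epsilon> e s) = a + b * s"
      using g e unfolding is_affine_extension_def by blast
    have "fst e \<in> lattice \<epsilon>" "snd e \<in> lattice \<epsilon>"
      using e by (auto simp: grid_edges_def lattice_adj_def)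
    moreover have "edge_point \<epsilon> e 0 = fst e" "edge_point \<epsilon> e \<epsilon> = snd e"
      using assms by (auto simp: edge_point_def)
    ultimately have "f (fst e) = a" "f (snd e) = a + b * \<epsilon>"
      using g ab assms unfolding is_affine_extension_def
      by (metis atLeastAtMost_iff less_eq_real_def mult_zero_right add.right_neutral,
          metis atLeastAtMost_iff less_eq_real_def)
    then show ?thesis using ab s assms by simp
  qed
  fix g h
  assume g: "g \<in> extensional (metric_grid \<epsilon>) \<and> is_affine_extension \<epsilon> f g"
    and h: "h \<in> extensional (metric_grid \<epsilon>) \<and> is_affine_extension \<epsilon> f h"
  show "g = h"
  proof (rule extensionalityI)
    fix z :: "real ^ 'n" assume "z \<in> metric_grid \<epsilon>"
    then obtain e s where "e \<in> grid_edges \<epsilon>" "s \<in> {0..\<epsilon>}" "z = edge_point \<epsilon> e s"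
      unfolding metric_grid_def by blast
    then show "g z = h z" using val[of g e s] val[of h e s] g h by simp
  qed (use g h in auto)
qed

end

theory Submission
  imports Defs
begin

text \<open>If \<open>v\<close> is continuous on \<open>[a, b]\<close> with weak derivative \<open>w \<in> L\<^sup>2\<close>, testing against
  \<open>C\<^sup>1\<close> approximations of the indicator function of \<open>[p, q]\<close> gives \<open>v(q) - v(p) = \<integral>\<^sub>p\<^sup>q w\<close>.
  Cauchy-Schwarz on every edge then yields the gradient inequality. On affine functions the
  fundamental theorem and Lebesgue's differentiation theorem show that \<open>w\<close> is the slope almost
  everywhere, so equality holds. The trace bound \<open>v(a)\<^sup>2 \<le> C (\<parallel>v\<parallel>\<^sup>2 + \<parallel>w\<parallel>\<^sup>2)\<close> puts the vertex
  values in \<open>\<ell>\<^sup>2\<close>, and \<open>H\<^sup>1\<close> of the lattice is just \<open>\<ell>\<^sup>2\<close>, because the discrete gradient is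
  bounded on \<open>\<ell>\<^sup>2\<close>.\<close>

subsection \<open>The fundamental theorem for weak derivatives\<close>


text \<open>Squaring removes the kink of the positive part: at 0 the difference quotient is at most
  \<open>\<bar>h\<bar>\<close> in absolute value. Shifted copies of this function make up
  \<open>ramp\<close>.\<close>

lemma DERIV_max_0_square:
  "((\<lambda>x::real. (max 0 x)\<^sup>2) has_real_derivative 2 * max 0 x) (at x)"
proof -
  consider "x < 0" | "x = 0" | "x > 0" by linarith
  then show ?thesis
  proof cases
    case 1
    have "((\<lambda>x::real. 0) has_real_derivative 2 * max 0 x) (at x)"
      using 1 by (auto intro!: derivative_eq_intros)
    then show ?thesis
      by (rule has_field_derivative_transform_within_open[of _ _ _ "{..<0}"]) (use 1 in auto)
  next
    case 2
    have "((\<lambda>h::real. (max 0 h)\<^sup>2 / h) \<longlongrightarrow> 0) (at 0)"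
    proof (rule Lim_null_comparison)
      have "\<bar>(max 0 h)\<^sup>2 / h\<bar> \<le> \<bar>h\<bar>" for h :: real
        by (cases "h > 0") (auto simp: max_def power2_eq_square)
      then show "\<forall>\<^sub>F h in at 0. norm ((max 0 h)\<^sup>2 / h) \<le> \<bar>h::real\<bar>"
        by simp
      show "((\<lambda>h::real. \<bar>h\<bar>) \<longlongrightarrow> 0) (at 0)"
        by (auto intro!: tendsto_eq_intros)
    qed
    then show ?thesis using 2 by (simp add: DERIV_def)
  next
    case 3
    have "((\<lambda>x::real. x\<^sup>2) has_real_derivative 2 * max 0 x) (at x)"
      using 3 by (auto intro!: derivative_eq_intros)
    then show ?thesis
      by (rule has_field_derivative_transform_within_open[of _ _ _ "{0<..}"]) (use 3 in auto)
  qed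
qed

text \<open>The tent over [0, 1] with peak 2 at 1/2, hence of mass 1.\<close>

definition hat :: "real \<Rightarrow> real" where
  "hat t = 4 * max 0 t - 8 * max 0 (t - 1/2) + 4 * max 0 (t - 1)"

text \<open>The antiderivative of \<open>hat\<close> that vanishes on the negative half-line; it
  climbs from 0 to 1 across [0, 1].\<close>

definition ramp :: "real \<Rightarrow> real" where
  "ramp t = 2 * (max 0 t)\<^sup>2 - 4 * (max 0 (t - 1/2))\<^sup>2 + 2 * (max 0 (t - 1))\<^sup>2"

lemma DERIV_ramp: "(ramp has_real_derivative hat t) (at t)"
proof -
  have *: "((\<lambda>x::real. (max 0 (x - c))\<^sup>2) has_real_derivative 2 * max 0 (t - c) * 1) (at t)" for c
    by (rule DERIV_chain2[OF DERIV_max_0_square]) (auto intro!: derivative_eq_intros)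
  show ?thesis unfolding ramp_def[abs_def] hat_def
    by (rule derivative_eq_intros DERIV_max_0_square * refl | simp)+
qed

lemma continuous_hat [continuous_intros]:
  "continuous_on S f \<Longrightarrow> continuous_on S (\<lambda>x. hat (f x))"
  unfolding hat_def by (intro continuous_intros)

lemma hat_nonneg: "hat t \<ge> 0"
  unfolding hat_def by (auto simp: max_def)

lemma hat_eq_0: "t \<le> 0 \<or> t \<ge> 1 \<Longrightarrow> hat t = 0"
  unfolding hat_def by (auto simp: max_def)

lemma ramp_eq_0: "t \<le> 0 \<Longrightarrow> ramp t = 0"
  by (simp add: ramp_def max_def)

lemma ramp_eq_1: "t \<ge> 1 \<Longrightarrow> ramp t = 1"
  by (auto simp: ramp_def max_def power2_eq_square algebra_simps)

lemma ramp_mono: "s \<le> t \<Longrightarrow> ramp s \<le> ramp t"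
  by (rule DERIV_nonneg_imp_nondecreasing) (use DERIV_ramp hat_nonneg in blast)+

lemma ramp_bounds: "0 \<le> ramp t" "ramp t \<le> 1"
  using ramp_mono[of "min t 0" t] ramp_mono[of t "max t 1"]
  by (auto simp: ramp_eq_0 ramp_eq_1)

text \<open>The derivative is the averaging kernel used below: nonnegative, supported in
  \<open>[c, c + h]\<close> and of mass 1.\<close>

lemma DERIV_ramp_affine:
  assumes "h > 0"
  shows "((\<lambda>x. ramp ((x - c) / h)) has_real_derivative hat ((x - c) / h) / h) (at x)"
proof -
  have "((\<lambda>x. (x - c) / h) has_real_derivative 1 / h) (at x)"
    using assms by (auto intro!: derivative_eq_intros)
  from DERIV_chain2[OF DERIV_ramp this] show ?thesis by simp
qed

text \<open>The rescaled tents form an approximate identity. Their windows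
  \<open>[c n, c n + h n]\<close> lie inside \<open>[a, b]\<close>, so no mass is lost even when
  \<open>x0\<close> is an endpoint.\<close>

lemma hat_average_tendsto:
  fixes v :: "real \<Rightarrow> real"
  assumes v: "continuous_on {a..b} v" and x0: "x0 \<in> {a..b}"
    and h: "\<And>n. h n > 0" "h \<longlonglongrightarrow> 0" and c: "\<And>n. a \<le> c n" "\<And>n. c n + h n \<le> b" "c \<longlonglongrightarrow> x0"
  shows "(\<lambda>n. integral {a..b} (\<lambda>x. v x * (hat ((x - c n) / h n) / h n))) \<longlonglongrightarrow> v x0"
proof (rule LIMSEQ_I)
  fix r :: real assume "r > 0"
  \<comment> \<open>The integral estimate yields only a non-strict bound by \<open>\<delta>\<close>;
    halving \<open>r\<close> makes it strict.\<close>
  define \<delta> where "\<delta> = r / 2"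
  have \<delta>: "\<delta> > 0" "\<delta> < r" using \<open>r > 0\<close> by (auto simp: \<delta>_def)
  obtain \<eta> where \<eta>: "\<eta> > 0" "\<And>x. x \<in> {a..b} \<Longrightarrow> \<bar>x - x0\<bar> < \<eta> \<Longrightarrow> \<bar>v x - v x0\<bar> < \<delta>"
    using v x0 \<delta>(1) unfolding continuous_on_iff dist_real_def by metis
  \<comment> \<open>Both ends of the window tend to \<open>x0\<close>, so eventually the whole
    support of the kernel is \<open>\<eta>\<close>-close to \<open>x0\<close>.\<close>
  have "(\<lambda>n. c n + h n) \<longlonglongrightarrow> x0 + 0" by (intro tendsto_add c h)
  then have "\<forall>\<^sub>F n in sequentially. \<bar>c n + h n - x0\<bar> < \<eta>"
    using \<eta>(1) by (auto simp: tendsto_iff dist_real_def)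
  moreover have "\<forall>\<^sub>F n in sequentially. \<bar>c n - x0\<bar> < \<eta>"
    using \<eta>(1) c(3) by (auto simp: tendsto_iff dist_real_def)
  ultimately have "\<forall>\<^sub>F n in sequentially.
      norm (integral {a..b} (\<lambda>x. v x * (hat ((x - c n) / h n) / h n)) - v x0) < r"
  proof eventually_elim
    case (elim n)
    define k where "k = (\<lambda>x. hat ((x - c n) / h n) / h n)"
    have k0: "k x \<ge> 0" for x using h(1)[of n] hat_nonneg by (simp add: k_def)
    have kc: "continuous_on {a..b} k"
      unfolding k_def using h(1)[of n] by (intro continuous_intros) auto
    have "(k has_integral ramp ((b - c n) / h n) - ramp ((a - c n) / h n)) {a..b}"
      unfolding k_def using x0 DERIV_ramp_affine[OF h(1)]
      by (intro fundamental_theorem_of_calculus)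
        (auto simp: has_real_derivative_iff_has_vector_derivative[symmetric]
            intro: has_field_derivative_at_within)
    moreover have "ramp ((b - c n) / h n) = 1" "ramp ((a - c n) / h n) = 0"
      using h(1)[of n] c(1,2)[of n] by (auto intro!: ramp_eq_1 ramp_eq_0 simp: field_simps)
    ultimately have k1: "(k has_integral 1) {a..b}" by simp
    have vk: "(\<lambda>x. v x * k x) integrable_on {a..b}"
      by (intro integrable_continuous_real continuous_intros v kc)
    \<comment> \<open>Since \<open>k\<close> has mass 1, \<open>v x0\<close> moves under the
      integral and only the oscillation of \<open>v\<close> over the window remains.\<close>
    have "integral {a..b} (\<lambda>x. v x * k x) - v x0 = integral {a..b} (\<lambda>x. v x * k x - v x0 * k x)"
      using vk k1 by (subst integral_diff) (auto simp: integrable_on_def integral_unique intro: has_integral_mult_right)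
    also have "norm \<dots> \<le> integral {a..b} (\<lambda>x. \<delta> * k x)"
    proof (rule integral_norm_bound_integral)
      show "(\<lambda>x. v x * k x - v x0 * k x) integrable_on {a..b}" "(\<lambda>x. \<delta> * k x) integrable_on {a..b}"
        by (intro integrable_continuous_real continuous_intros v kc)+
      fix x assume x: "x \<in> {a..b}"
      show "norm (v x * k x - v x0 * k x) \<le> \<delta> * k x"
      proof (cases "c n \<le> x \<and> x \<le> c n + h n")
        case True
        then have "\<bar>x - x0\<bar> < \<eta>" using elim by auto
        then have "\<bar>v x - v x0\<bar> \<le> \<delta>" using \<eta>(2) x by (simp add: less_imp_le)
        then show ?thesis
          using k0 by (simp add: abs_mult mult_right_mono flip: left_diff_distrib)
      next
        case False
        then have "k x = 0"
          using h(1)[of n] by (auto simp: k_def field_simps intro!: hat_eq_0)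
        then show ?thesis by simp
      qed
    qed
    also have "\<dots> = \<delta>" using k1 by (simp add: integral_unique)
    finally show ?case using \<delta> by (simp add: k_def)
  qed
  then show "\<exists>N. \<forall>n\<ge>N. norm (integral {a..b} (\<lambda>x. v x * (hat ((x - c n) / h n) / h n)) - v x0) < r"
    by (simp add: eventually_sequentially)
qed

section \<open>Square-integrable weak derivatives on an interval\<close>

lemma finite_measure_lebesgue_on_interval: "finite_measure (lebesgue_on {a..b::real})"
  by (rule finite_measure_lebesgue_on) auto

text \<open>This links the extended nonnegative integral in \<open>L2_sqnorm\<close> with the gauge
  integral \<open>integral\<close>. Integrability of \<open>w\<close> itself comes from the finite
  length of the interval.\<close>

lemma L2_space_lebesgue_onD:
  assumes "w \<in> L2_space (lebesgue_on {a..b::real})"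
  shows "w \<in> borel_measurable (lebesgue_on {a..b})"
    and "integrable (lebesgue_on {a..b}) (\<lambda>x. (w x)\<^sup>2)"
    and "integrable (lebesgue_on {a..b}) w"
    and "L2_sqnorm (lebesgue_on {a..b}) w = ennreal (integral {a..b} (\<lambda>x. (w x)\<^sup>2))"
proof -
  show 1[measurable]: "w \<in> borel_measurable (lebesgue_on {a..b})"
    using assms by (simp add: L2_space_def)
  show 2: "integrable (lebesgue_on {a..b}) (\<lambda>x. (w x)\<^sup>2)"
    using assms by (intro integrableI_nonneg) (auto simp: L2_space_def L2_sqnorm_def)
  show "integrable (lebesgue_on {a..b}) w"
    by (rule finite_measure.square_integrable_imp_integrable
        [OF finite_measure_lebesgue_on_interval 1 2])
  show "L2_sqnorm (lebesgue_on {a..b}) w = ennreal (integral {a..b} (\<lambda>x. (w x)\<^sup>2))"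
    unfolding L2_sqnorm_def using 2
    by (subst nn_integral_eq_integral) (auto simp: lebesgue_integral_eq_integral)
qed

text \<open>The test functions \<open>\<phi> n\<close> rise near \<open>p\<close>, fall near
  \<open>q\<close> and equal 1 in between. Their derivatives average \<open>v\<close> just right of
  \<open>p\<close> and, with a minus sign, just left of \<open>q\<close>; continuity turns these
  averages into point values. Dominated convergence produces the integral of
  \<open>w\<close>.\<close>

lemma weak_deriv_FTC:
  assumes v: "continuous_on {a..b} v" and w: "w \<in> L2_space (lebesgue_on {a..b})"
    and vw: "is_weak_deriv a b v w" and pq: "a \<le> p" "p < q" "q \<le> b"
  shows "integral {p..q} w = v q - v p"
proof -
  \<comment> \<open>The factor 1/4 gives \<open>4 * h n \<le> q - p\<close>, so the rising ramp,
    which ends at \<open>p + 2 * h n\<close>, is complete before the falling one starts at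
    \<open>q - 2 * h n\<close>.\<close>
  define h where "h = (\<lambda>n::nat. (q - p) / 4 * inverse (real (Suc n)))"
  have h0: "h n > 0" for n using pq by (simp add: h_def)
  have h4: "4 * h n \<le> q - p" for n
    using pq mult_left_mono[of "inverse (real (Suc n))" 1 "q - p"]
    by (simp add: h_def inverse_le_1_iff)
  have "h \<longlonglongrightarrow> (q - p) / 4 * 0"
    unfolding h_def by (intro tendsto_mult tendsto_const LIMSEQ_inverse_real_of_nat)
  then have hlim: "h \<longlonglongrightarrow> 0" by simp
  \<comment> \<open>The ramps occupy \<open>[p + h n, p + 2 * h n]\<close> and
    \<open>[q - 2 * h n, q - h n]\<close>. The gap \<open>h n\<close> at either end keeps the
    support compact in the open interval even if \<open>p = a\<close> or
    \<open>q = b\<close>.\<close>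
  define c d where "c = (\<lambda>n. p + h n)" and "d = (\<lambda>n. q - 2 * h n)"
  define \<phi> where "\<phi> = (\<lambda>n x. ramp ((x - c n) / h n) - ramp ((x - d n) / h n))"
  define \<psi> where "\<psi> = (\<lambda>n x. hat ((x - c n) / h n) / h n - hat ((x - d n) / h n) / h n)"
  have D: "(\<phi> n has_real_derivative \<psi> n x) (at x)" for n x
    unfolding \<phi>_def \<psi>_def by (intro derivative_intros DERIV_ramp_affine h0)
  then have deriv: "deriv (\<phi> n) = \<psi> n" for n by (simp add: DERIV_imp_deriv fun_eq_iff)
  have \<psi>cont: "continuous_on S (\<psi> n)" for n S
    unfolding \<psi>_def using h0[of n] by (intro continuous_intros) auto
  have \<phi>cont: "continuous_on S (\<phi> n)" for n S
    using D by (meson DERIV_continuous_on has_field_derivative_at_within)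
  have "test_function a b (\<phi> n)" for n
    unfolding test_function_def
  proof (intro conjI exI[of _ "{c n..d n + h n}"] allI impI)
    show "\<phi> n C1_differentiable_on UNIV"
      unfolding C1_differentiable_on_def using D \<psi>cont
      by (metis has_real_derivative_iff_has_vector_derivative)
    show "{c n..d n + h n} \<subseteq> {a<..<b}" using h0[of n] pq by (auto simp: c_def d_def)
    fix x assume "x \<notin> {c n..d n + h n}"
    then consider "x < c n" | "x > d n + h n" by fastforce
    then show "\<phi> n x = 0"
    proof cases
      case 1
      then have "(x - c n) / h n \<le> 0" "(x - d n) / h n \<le> 0"
        using h0[of n] h4[of n] by (auto simp: c_def d_def divide_nonpos_pos)
      then show ?thesis by (simp add: \<phi>_def ramp_eq_0)
    next
      case 2
      then have "(x - c n) / h n \<ge> 1" "(x - d n) / h n \<ge> 1"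
        using h0[of n] h4[of n] by (auto simp: c_def d_def field_simps)
      then show ?thesis by (simp add: \<phi>_def ramp_eq_1)
    qed
  qed simp
  note test = this
  have eq: "integral {a..b} (\<lambda>x. v x * \<psi> n x) = - (\<integral>x. w x * \<phi> n x \<partial>lebesgue_on {a..b})" for n
    using vw test[of n] unfolding is_weak_deriv_def deriv[symmetric]
    by (subst lebesgue_integral_eq_integral[symmetric])
       (auto intro!: continuous_imp_integrable_real continuous_intros v \<psi>cont simp: deriv)
  have "(\<lambda>n. integral {a..b} (\<lambda>x. v x * (hat ((x - c n) / h n) / h n)) -
             integral {a..b} (\<lambda>x. v x * (hat ((x - d n) / h n) / h n))) \<longlonglongrightarrow> v p - v q"
  proof (intro tendsto_diff hat_average_tendsto v h0 hlim)
    show "c \<longlonglongrightarrow> p" "d \<longlonglongrightarrow> q"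
      using tendsto_add[OF tendsto_const hlim, of p]
        tendsto_diff[OF tendsto_const tendsto_mult[OF tendsto_const hlim], of q 2]
      by (simp_all add: c_def d_def)
    show "a \<le> c n" "c n + h n \<le> b" "a \<le> d n" "d n + h n \<le> b" for n
      using h0[of n] h4[of n] pq by (auto simp: c_def d_def)
  qed (use pq in auto)
  also have "(\<lambda>n. integral {a..b} (\<lambda>x. v x * (hat ((x - c n) / h n) / h n)) -
             integral {a..b} (\<lambda>x. v x * (hat ((x - d n) / h n) / h n))) =
             (\<lambda>n. integral {a..b} (\<lambda>x. v x * \<psi> n x))"
    unfolding \<psi>_def right_diff_distrib
    by (intro ext integral_diff[symmetric] integrable_continuous_real continuous_intros v)
       (use h0 in \<open>auto simp: less_imp_neq[symmetric]\<close>)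
  finally have lim1: "(\<lambda>n. integral {a..b} (\<lambda>x. v x * \<psi> n x)) \<longlonglongrightarrow> v p - v q" .
  have lim2: "(\<lambda>n. \<integral>x. w x * \<phi> n x \<partial>lebesgue_on {a..b}) \<longlonglongrightarrow>
      (\<integral>x. w x * indicator {p<..<q} x \<partial>lebesgue_on {a..b})"
  proof (rule integral_dominated_convergence)
    note [measurable] = L2_space_lebesgue_onD(1)[OF w]
    have [measurable]: "\<phi> n \<in> borel_measurable (lebesgue_on {a..b})" for n
      by (rule continuous_imp_measurable_on_sets_lebesgue[OF \<phi>cont]) auto
    show "(\<lambda>x. w x * \<phi> n x) \<in> borel_measurable (lebesgue_on {a..b})" for n by measurable
    have "{p<..<q} \<inter> {a..b} \<in> sets (lebesgue_on {a..b})"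
      by (auto simp: sets_restrict_space)
    then have [measurable]: "(indicator {p<..<q} :: real \<Rightarrow> real) \<in> borel_measurable (lebesgue_on {a..b})"
      by (subst borel_measurable_indicator_iff) (auto simp: Int_commute)
    show "(\<lambda>x. w x * indicator {p<..<q} x) \<in> borel_measurable (lebesgue_on {a..b})" by measurable
    show "integrable (lebesgue_on {a..b}) (\<lambda>x. \<bar>w x\<bar>)"
      using L2_space_lebesgue_onD(3)[OF w] by simp
    have "\<bar>\<phi> n x\<bar> \<le> 1" for n x
      using ramp_bounds[of "(x - c n) / h n"] ramp_bounds[of "(x - d n) / h n"]
      unfolding \<phi>_def by linarith
    then show "AE x in lebesgue_on {a..b}. norm (w x * \<phi> n x) \<le> \<bar>w x\<bar>" for n
      by (auto simp: abs_mult mult_left_le)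
    \<comment> \<open>All \<open>\<phi> n\<close> vanish at \<open>p\<close> and \<open>q\<close>,
      so the limit is the indicator of the open interval. A point inside lies between the two ramps
      once \<open>2 * h n\<close> is below its distances to \<open>p\<close> and
      \<open>q\<close>.\<close>
    have "(\<lambda>n. \<phi> n x) \<longlonglongrightarrow> indicator {p<..<q} x" for x
    proof (cases "x \<in> {p<..<q}")
      case True
      have "\<forall>\<^sub>F n in sequentially. h n < min (x - p) (q - x) / 2"
        using True order_tendstoD(2)[OF hlim, of "min (x - p) (q - x) / 2"] by auto
      then have "\<forall>\<^sub>F n in sequentially. \<phi> n x = indicator {p<..<q} x"
      proof eventually_elim
        case (elim n)
        then have "(x - c n) / h n \<ge> 1" "(x - d n) / h n \<le> 0"
          using h0[of n] by (auto simp: c_def d_def field_simps)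
        then show ?case using True by (simp add: \<phi>_def ramp_eq_0 ramp_eq_1)
      qed
      then show ?thesis by (rule tendsto_eventually)
    next
      case False
      have "\<phi> n x = 0" for n
      proof (cases "x \<le> p")
        case True
        then have "(x - c n) / h n \<le> 0" "(x - d n) / h n \<le> 0"
          using h0[of n] h4[of n] by (auto simp: c_def d_def divide_nonpos_pos)
        then show ?thesis by (simp add: \<phi>_def ramp_eq_0)
      next
        case 2: False
        then have "(x - c n) / h n \<ge> 1" "(x - d n) / h n \<ge> 1"
          using False h0[of n] h4[of n] by (auto simp: c_def d_def field_simps)
        then show ?thesis by (simp add: \<phi>_def ramp_eq_1)
      qed
      then show ?thesis using False by simp
    qed
    then show "AE x in lebesgue_on {a..b}. (\<lambda>n. w x * \<phi> n x) \<longlonglongrightarrow> w x * indicator {p<..<q} x"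
      by (auto intro!: tendsto_mult)
  qed
  have "(\<integral>x. w x * indicator {p<..<q} x \<partial>lebesgue_on {a..b}) = integral {p..q} w"
  proof -
    have "integrable (lebesgue_on {a..b}) (\<lambda>x. w x * indicator {p<..<q} x)"
      using L2_space_lebesgue_onD(3)[OF w]
      by (intro integrable_real_mult_indicator) (use pq in \<open>auto simp: sets_restrict_space_iff\<close>)
    then have "(\<integral>x. w x * indicator {p<..<q} x \<partial>lebesgue_on {a..b}) =
        integral {a..b} (\<lambda>x. w x * indicator {p<..<q} x)"
      by (intro lebesgue_integral_eq_integral) auto
    also have "\<dots> = integral {a..b} (\<lambda>x. if x \<in> {p<..<q} then w x else 0)"
      by (intro integral_cong) (auto simp: indicator_def)
    also have "\<dots> = integral {p<..<q} w"
      using pq by (subst integral_restrict_Int) (auto intro: arg_cong[where f="\<lambda>S. integral S w"])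
    also have "\<dots> = integral {p..q} w"
      by (simp add: integral_open_interval_real)
    finally show ?thesis .
  qed
  with lim2 have "(\<lambda>n. - integral {a..b} (\<lambda>x. v x * \<psi> n x)) \<longlonglongrightarrow> integral {p..q} w"
    unfolding eq by simp
  from tendsto_minus[OF this] LIMSEQ_unique[OF lim1] show ?thesis by fastforce
qed


subsection \<open>Edge estimates\<close>


text \<open>Cauchy-Schwarz, obtained by expanding the nonnegative integral of
  \<open>(w x - m)\<^sup>2\<close> over \<open>[p, q]\<close>. Keeping the integral over all of
  \<open>[a, b]\<close> on the right gives one constant for all pairs \<open>p\<close>,
  \<open>q\<close>, as the trace bound requires.\<close>

lemma weak_deriv_jump_bound:
  assumes v: "continuous_on {a..b} v" and w: "w \<in> L2_space (lebesgue_on {a..b})"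
    and vw: "is_weak_deriv a b v w" and pq: "a \<le> p" "p < q" "q \<le> b"
  shows "(v q - v p)\<^sup>2 \<le> (q - p) * integral {a..b} (\<lambda>x. (w x)\<^sup>2)"
proof -
  \<comment> \<open>By \<open>weak_deriv_FTC\<close> this slope is the mean of \<open>w\<close> over
    \<open>[p, q]\<close>, the value that minimises the expanded square.\<close>
  define m where "m = (v q - v p) / (q - p)"
  have I: "w integrable_on {a..b}" "(\<lambda>x. (w x)\<^sup>2) integrable_on {a..b}"
    using L2_space_lebesgue_onD[OF w] by (auto intro: integrable_on_lebesgue_on)
  have J: "w integrable_on {p..q}" "(\<lambda>x. (w x)\<^sup>2) integrable_on {p..q}"
    by (rule integrable_on_subinterval[OF I(1)] integrable_on_subinterval[OF I(2)]; use pq in auto)+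
  have "((\<lambda>x. (w x)\<^sup>2 - 2 * m * w x + m\<^sup>2) has_integral
      (integral {p..q} (\<lambda>x. (w x)\<^sup>2) - 2 * m * integral {p..q} w + (q - p) * m\<^sup>2)) {p..q}"
    using has_integral_const_real[of "m\<^sup>2" p q] pq J
    by (intro has_integral_add has_integral_diff has_integral_mult_right)
       (auto simp: has_integral_integral)
  then have "0 \<le> integral {p..q} (\<lambda>x. (w x)\<^sup>2) - 2 * m * integral {p..q} w + (q - p) * m\<^sup>2"
  proof (rule has_integral_nonneg)
    fix x
    have "(w x)\<^sup>2 - 2 * m * w x + m\<^sup>2 = (w x - m)\<^sup>2" by (simp add: power2_diff)
    then show "0 \<le> (w x)\<^sup>2 - 2 * m * w x + m\<^sup>2" by simp
  qed
  also have "\<dots> = integral {p..q} (\<lambda>x. (w x)\<^sup>2) - (v q - v p)\<^sup>2 / (q - p)"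
  proof -
    have "(q - p) * m = v q - v p" using pq by (simp add: m_def)
    then have "(q - p) * m\<^sup>2 = m * (v q - v p)" "(v q - v p)\<^sup>2 / (q - p) = m * (v q - v p)"
      by (simp_all add: power2_eq_square m_def)
    then show ?thesis unfolding weak_deriv_FTC[OF v w vw pq] by simp
  qed
  also have "\<dots> \<le> integral {a..b} (\<lambda>x. (w x)\<^sup>2) - (v q - v p)\<^sup>2 / (q - p)"
    using I J pq by (intro diff_right_mono integral_subset_le) auto
  finally show ?thesis using pq by (simp add: field_simps)
qed

lemma weak_deriv_spec:
  assumes "v \<in> H1_interval a b"
  shows "weak_deriv a b v \<in> L2_space (lebesgue_on {a..b})"
    and "is_weak_deriv a b v (weak_deriv a b v)"
proof -
  have "\<exists>w. w \<in> L2_space (lebesgue_on {a..b}) \<and> is_weak_deriv a b v w"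
    using assms by (auto simp: H1_interval_def)
  from someI_ex[OF this] show "weak_deriv a b v \<in> L2_space (lebesgue_on {a..b})"
    "is_weak_deriv a b v (weak_deriv a b v)"
    unfolding weak_deriv_def by auto
qed

lemma continuous_on_imp_L2_space:
  fixes v :: "real \<Rightarrow> real"
  assumes "continuous_on {a..b} v"
  shows "v \<in> L2_space (lebesgue_on {a..b})"
proof -
  have "integrable (lebesgue_on {a..b}) (\<lambda>x. (v x)\<^sup>2)"
    by (intro continuous_imp_integrable_real continuous_intros assms)
  moreover have "v \<in> borel_measurable (lebesgue_on {a..b})"
    by (rule continuous_imp_measurable_on_sets_lebesgue[OF assms]) auto
  ultimately show ?thesis
    by (auto simp: L2_space_def L2_sqnorm_def real_integrable_def less_top)
qed

lemma test_function_zero: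
  assumes "test_function a b \<phi>" "x \<notin> {a<..<b}"
  shows "\<phi> x = 0"
  using assms unfolding test_function_def by blast

section \<open>Weak derivatives of affine functions\<close>

text \<open>Integration by parts; the boundary terms vanish because a test function is zero at
  \<open>a\<close> and \<open>b\<close>.\<close>

lemma is_weak_deriv_affine:
  assumes "a < b" and v: "\<And>s. s \<in> {a..b} \<Longrightarrow> v s = \<alpha> + \<beta> * s"
  shows "is_weak_deriv a b v (\<lambda>_. \<beta>)"
  unfolding is_weak_deriv_def
proof (intro allI impI)
  fix \<phi> assume \<phi>: "test_function a b \<phi>"
  then obtain D where D: "\<And>x. (\<phi> has_real_derivative D x) (at x)" "continuous_on UNIV D"
    unfolding test_function_def C1_differentiable_on_def
    by (auto simp: has_real_derivative_iff_has_vector_derivative)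
  have deriv: "deriv \<phi> = D" using D by (simp add: DERIV_imp_deriv fun_eq_iff)
  have \<phi>c: "continuous_on {a..b} \<phi>"
    using D(1) by (meson DERIV_continuous_on has_field_derivative_at_within)
  have Dc: "continuous_on {a..b} D" using D(2) continuous_on_subset by blast
  have "((\<lambda>s. (\<alpha> + \<beta> * s) * D s + \<beta> * \<phi> s) has_integral
      (\<alpha> + \<beta> * b) * \<phi> b - (\<alpha> + \<beta> * a) * \<phi> a) {a..b}"
    using assms(1)
    by (intro fundamental_theorem_of_calculus)
       (auto simp: has_real_derivative_iff_has_vector_derivative[symmetric]
          intro!: derivative_eq_intros has_field_derivative_at_within[OF D(1)])
  then have 0: "integral {a..b} (\<lambda>s. (\<alpha> + \<beta> * s) * D s + \<beta> * \<phi> s) = 0"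
    using test_function_zero[OF \<phi>] by (simp add: integral_unique)
  have "integral {a..b} (\<lambda>s. (\<alpha> + \<beta> * s) * D s) + integral {a..b} (\<lambda>s. \<beta> * \<phi> s) = 0"
    unfolding 0[symmetric]
    by (intro integral_add[symmetric] integrable_continuous_real continuous_intros \<phi>c Dc)
  moreover have "(\<integral>x. v x * deriv \<phi> x \<partial>lebesgue_on {a..b}) =
      integral {a..b} (\<lambda>s. (\<alpha> + \<beta> * s) * D s)"
    by (subst lebesgue_integral_eq_integral[symmetric])
       (auto intro!: continuous_imp_integrable_real continuous_intros \<phi>c Dc
          Bochner_Integration.integral_cong simp: deriv v)
  moreover have "(\<integral>x. \<beta> * \<phi> x \<partial>lebesgue_on {a..b}) = integral {a..b} (\<lambda>s. \<beta> * \<phi> s)"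
    by (subst lebesgue_integral_eq_integral[symmetric])
       (auto intro!: continuous_imp_integrable_real continuous_intros \<phi>c)
  ultimately show "(\<integral>x. v x * deriv \<phi> x \<partial>lebesgue_on {a..b}) = - (\<integral>x. \<beta> * \<phi> x \<partial>lebesgue_on {a..b})"
    by linarith
qed

text \<open>Since \<open>weak_deriv\<close> is an arbitrary choice, its norm is computed by treating
  every admissible \<open>w\<close>. By \<open>weak_deriv_FTC\<close> the mean of \<open>w\<close>
  over \<open>[x, x + h]\<close> is exactly \<open>\<beta>\<close>, and right-sided means recover
  \<open>w\<close> outside a null set.\<close>

lemma weak_deriv_affine_unique:
  assumes ab: "a < b" and v: "\<And>s. s \<in> {a..b} \<Longrightarrow> v s = \<alpha> + \<beta> * s"
    and w: "w \<in> L2_space (lebesgue_on {a..b})" "is_weak_deriv a b v w"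
  shows "negligible {x \<in> {a..b}. w x \<noteq> \<beta>}"
proof -
  have vc: "continuous_on {a..b} v"
    by (rule continuous_on_eq[of _ "\<lambda>s. \<alpha> + \<beta> * s"]) (auto simp: v intro!: continuous_intros)
  \<comment> \<open>Extension by zero provides integrability on every box, as the differentiation
    theorem demands.\<close>
  define g where "g = (\<lambda>x. if x \<in> {a..b} then w x else 0)"
  have "w integrable_on {a..b}"
    using L2_space_lebesgue_onD[OF w(1)] by (auto intro: integrable_on_lebesgue_on)
  then have "g integrable_on UNIV" unfolding g_def by (subst integrable_restrict_UNIV)
  then have "g integrable_on cbox c d" for c d by (rule integrable_on_subcbox) auto
  then obtain N where N: "negligible N" "\<And>x e. \<lbrakk>x \<notin> N; 0 < e\<rbrakk> \<Longrightarrow> \<exists>d>0. \<forall>h. 0 < h \<and> h < d \<longrightarrow>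
      norm (integral (cbox x (x + h *\<^sub>R One)) g /\<^sub>R h ^ DIM(real) - g x) < e"
    by (rule integrable_ccontinuous_explicit[of g]) blast
  have "w x = \<beta>" if x: "x \<in> {a..<b}" "x \<notin> N" for x
  proof (rule ccontr)
    assume "w x \<noteq> \<beta>"
    \<comment> \<open>The gap itself serves as tolerance: a mean equal to \<open>\<beta>\<close>
      stays at exactly this distance from \<open>w x\<close>.\<close>
    then have "\<bar>w x - \<beta>\<bar> > 0" by simp
    from N(2)[OF x(2) this] obtain d where d: "d > 0" "\<And>h. 0 < h \<Longrightarrow> h < d \<Longrightarrow>
      \<bar>integral {x..x + h} g / h - g x\<bar> < \<bar>w x - \<beta>\<bar>"
      by (auto simp: divide_inverse_commute)
    \<comment> \<open>The bound \<open>b - x\<close> keeps the window inside the interval, and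
      \<open>d / 2\<close> makes \<open>h < d\<close> strict.\<close>
    define h where "h = min (d / 2) (b - x)"
    have h: "0 < h" "h < d" "x + h \<le> b" using d(1) x by (auto simp: h_def)
    have "integral {x..x + h} g = integral {x..x + h} w"
      by (rule integral_cong) (use h x in \<open>auto simp: g_def\<close>)
    also have "\<dots> = v (x + h) - v x"
      by (rule weak_deriv_FTC[OF vc w]) (use h x in auto)
    also have "\<dots> = \<beta> * h"
      using h x by (simp add: v algebra_simps)
    finally show False using d(2)[OF h(1,2)] h x by (simp add: g_def abs_minus_commute)
  qed
  \<comment> \<open>There is no window to the right of \<open>b\<close>, so this point joins the
    exceptional set.\<close>
  then have "{x \<in> {a..b}. w x \<noteq> \<beta>} \<subseteq> insert b N" by force
  then show ?thesis using N(1) negligible_subset by (metis negligible_insert)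
qed

lemma affine_H1_interval:
  assumes ab: "a < b" and v: "\<And>s. s \<in> {a..b} \<Longrightarrow> v s = \<alpha> + \<beta> * s"
  shows "v \<in> H1_interval a b"
    and "L2_sqnorm (lebesgue_on {a..b}) (weak_deriv a b v) = ennreal ((b - a) * \<beta>\<^sup>2)"
proof -
  have vc: "continuous_on {a..b} v"
    by (rule continuous_on_eq[of _ "\<lambda>s. \<alpha> + \<beta> * s"]) (auto simp: v intro!: continuous_intros)
  have "(\<lambda>_. \<beta>) \<in> L2_space (lebesgue_on {a..b})" by (rule continuous_on_imp_L2_space) auto
  then show H: "v \<in> H1_interval a b"
    using is_weak_deriv_affine[OF ab v] continuous_on_imp_L2_space[OF vc]
    by (auto simp: H1_interval_def)
  have "integral {a..b} (\<lambda>x. (weak_deriv a b v x)\<^sup>2) = integral {a..b} (\<lambda>x. \<beta>\<^sup>2)"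
    by (rule integral_spike[OF weak_deriv_affine_unique[OF ab v weak_deriv_spec[OF H]]]) auto
  also have "\<dots> = (b - a) * \<beta>\<^sup>2" using ab by simp
  finally show "L2_sqnorm (lebesgue_on {a..b}) (weak_deriv a b v) = ennreal ((b - a) * \<beta>\<^sup>2)"
    using L2_space_lebesgue_onD(4)[OF weak_deriv_spec(1)[OF H]] by simp
qed

lemma H1_interval_jump_bound:
  assumes "a < b" "v \<in> H1_interval a b" "continuous_on {a..b} v"
  shows "ennreal ((v b - v a)\<^sup>2 / (b - a)) \<le> L2_sqnorm (lebesgue_on {a..b}) (weak_deriv a b v)"
proof -
  note w = weak_deriv_spec[OF assms(2)]
  have "(v b - v a)\<^sup>2 / (b - a) \<le> integral {a..b} (\<lambda>x. (weak_deriv a b v x)\<^sup>2)"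
    using weak_deriv_jump_bound[OF assms(3) w, of a b] assms(1) by (simp add: field_simps)
  then show ?thesis using L2_space_lebesgue_onD(4)[OF w(1)] by (simp add: ennreal_leI)
qed

text \<open>Average \<open>v(a)\<^sup>2 \<le> 2 v(s)\<^sup>2 + 2 (v(s) - v(a))\<^sup>2\<close> over \<open>s\<close>.\<close>

lemma H1_interval_trace_bound:
  assumes ab: "a < b" and v: "v \<in> H1_interval a b" "continuous_on {a..b} v"
  shows "ennreal ((v a)\<^sup>2) \<le> ennreal (2 / (b - a)) * L2_sqnorm (lebesgue_on {a..b}) v
     + ennreal (2 * (b - a)) * L2_sqnorm (lebesgue_on {a..b}) (weak_deriv a b v)"
proof -
  note w = weak_deriv_spec[OF v(1)]
  define V where "V = integral {a..b} (\<lambda>x. (v x)\<^sup>2)"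
  define W where "W = integral {a..b} (\<lambda>x. (weak_deriv a b v x)\<^sup>2)"
  have WV: "W \<ge> 0" "V \<ge> 0"
    unfolding W_def V_def
    using L2_space_lebesgue_onD(2)[OF w(1)]
      L2_space_lebesgue_onD(2)[OF continuous_on_imp_L2_space[OF v(2)]]
    by (auto intro!: integral_nonneg integrable_on_lebesgue_on)
  have "integral {a..b} (\<lambda>s. (v a)\<^sup>2) \<le> integral {a..b} (\<lambda>s. 2 * (v s)\<^sup>2 + 2 * ((b - a) * W))"
  proof (rule integral_le)
    fix s assume s: "s \<in> {a..b}"
    have "(v s - v a)\<^sup>2 \<le> (s - a) * W"
    \<comment> \<open>\<open>weak_deriv_jump_bound\<close> needs two distinct points; for
      \<open>s = a\<close> both sides are 0.\<close>
    proof (cases "s = a")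
      case False
      then show ?thesis unfolding W_def using s by (intro weak_deriv_jump_bound v w) auto
    qed simp
    also have "\<dots> \<le> (b - a) * W" using s WV by (intro mult_right_mono) auto
    finally have "(v s - v a)\<^sup>2 \<le> (b - a) * W" .
    \<comment> \<open>The right side minus the left side is
      \<open>(2 * v s - v a)\<^sup>2\<close>.\<close>
    moreover have "(v a)\<^sup>2 \<le> 2 * (v s)\<^sup>2 + 2 * (v s - v a)\<^sup>2"
      using zero_le_power2[of "2 * v s - v a"] by (simp add: power2_eq_square algebra_simps)
    ultimately show "(v a)\<^sup>2 \<le> 2 * (v s)\<^sup>2 + 2 * ((b - a) * W)" by linarith
  qed (intro integrable_continuous_real continuous_intros v)+
  also have "\<dots> = integral {a..b} (\<lambda>s. 2 * (v s)\<^sup>2) + integral {a..b} (\<lambda>s. 2 * ((b - a) * W))"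
    by (intro integral_add integrable_continuous_real continuous_intros v)
  also have "\<dots> = 2 * V + (b - a) * (2 * ((b - a) * W))" using ab by (simp add: V_def)
  finally have "(v a)\<^sup>2 \<le> 2 / (b - a) * V + 2 * (b - a) * W"
    using ab by (simp add: field_simps power2_eq_square)
  then have "ennreal ((v a)\<^sup>2) \<le> ennreal (2 / (b - a) * V + 2 * (b - a) * W)"
    by (rule ennreal_leI)
  also have "\<dots> = ennreal (2 / (b - a) * V) + ennreal (2 * (b - a) * W)"
    using ab WV by (intro ennreal_plus) auto
  also have "\<dots> = ennreal (2 / (b - a)) * ennreal V + ennreal (2 * (b - a)) * ennreal W"
    by (simp only: ennreal_mult''[OF WV(1)] ennreal_mult''[OF WV(2)])
  finally show ?thesis
    using L2_space_lebesgue_onD(4)[OF w(1)] L2_space_lebesgue_onD(4)[OF continuous_on_imp_L2_space[OF v(2)]]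
    by (simp add: V_def W_def)
qed


subsection \<open>The lattice\<close>


text \<open>A bound on the norm confines the integer coordinates to a finite box. This makes
  truncated functions finitely supported and the grid locally finite.\<close>

lemma finite_lattice_norm_le:
  assumes "\<epsilon> > 0"
  shows "finite {x \<in> lattice \<epsilon> :: (real ^ 'n) set. norm x \<le> R}"
proof (rule finite_subset)
  let ?K = "PiE (UNIV :: 'n set) (\<lambda>_. {-\<lceil>R / \<epsilon>\<rceil>..\<lceil>R / \<epsilon>\<rceil>})"
  show "finite ((\<lambda>k. \<chi> i. \<epsilon> * of_int (k i)) ` ?K)" by (intro finite_imageI finite_PiE) auto
  show "{x \<in> lattice \<epsilon> :: (real ^ 'n) set. norm x \<le> R} \<subseteq> (\<lambda>k. \<chi> i. \<epsilon> * of_int (k i)) ` ?K"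
  proof
    fix x :: "real ^ 'n" assume x: "x \<in> {x \<in> lattice \<epsilon>. norm x \<le> R}"
    then obtain k :: "'n \<Rightarrow> int" where k: "\<And>i. x $ i = \<epsilon> * of_int (k i)"
      unfolding lattice_def mem_Collect_eq by metis
    have "k i \<in> {-\<lceil>R / \<epsilon>\<rceil>..\<lceil>R / \<epsilon>\<rceil>}" for i
    proof -
      have "\<bar>\<epsilon> * of_int (k i)\<bar> \<le> R" using component_le_norm_cart[of x i] x k by simp
      then have "\<bar>of_int (k i)\<bar> \<le> R / \<epsilon>" using assms by (simp add: abs_mult field_simps)
      then show ?thesis by (auto simp: minus_le_iff) linarith+
    qed
    then show "x \<in> (\<lambda>k. \<chi> i. \<epsilon> * of_int (k i)) ` ?K"
      by (intro image_eqI[of _ _ k]) (auto simp: vec_eq_iff k)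
  qed
qed

lemma lattice_translate:
  assumes "x \<in> lattice \<epsilon>"
  shows "x + \<epsilon> *\<^sub>R axis i 1 \<in> lattice \<epsilon>" "x - \<epsilon> *\<^sub>R axis i 1 \<in> lattice \<epsilon>"
proof -
  obtain k where k: "\<And>j. x $ j = \<epsilon> * of_int (k j)"
    using assms unfolding lattice_def mem_Collect_eq by metis
  have "(x + \<epsilon> *\<^sub>R axis i 1) $ j = \<epsilon> * of_int (if j = i then k j + 1 else k j)"
    "(x - \<epsilon> *\<^sub>R axis i 1) $ j = \<epsilon> * of_int (if j = i then k j - 1 else k j)" for j
    by (auto simp: k axis_def algebra_simps)
  then show "x + \<epsilon> *\<^sub>R axis i 1 \<in> lattice \<epsilon>" "x - \<epsilon> *\<^sub>R axis i 1 \<in> lattice \<epsilon>"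
    unfolding lattice_def by blast+
qed

lemma bij_betw_lattice_translate:
  "bij_betw (\<lambda>x. x + \<epsilon> *\<^sub>R axis i 1) (lattice \<epsilon>) (lattice \<epsilon>)"
  by (rule bij_betwI[of _ _ _ "\<lambda>x. x - \<epsilon> *\<^sub>R axis i 1"]) (auto simp: lattice_translate)

lemma nn_integral_lattice_translate:
  "(\<integral>\<^sup>+ x. g (x + \<epsilon> *\<^sub>R axis i 1) \<partial>count_space (lattice \<epsilon>)) = (\<integral>\<^sup>+ x. g x \<partial>count_space (lattice \<epsilon>))"
  by (rule nn_integral_bij_count_space[OF bij_betw_lattice_translate])

text \<open>An edge is determined by its lower endpoint and its axis, so a sum over edges splits
  into one lattice sum per axis.\<close>

lemma nn_integral_grid_edges:
  fixes g :: "(real ^ 'n) \<times> (real ^ 'n) \<Rightarrow> ennreal"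
  assumes "\<epsilon> > 0"
  shows "(\<integral>\<^sup>+ e. g e \<partial>count_space (grid_edges \<epsilon>)) =
    (\<Sum>i\<in>UNIV. \<integral>\<^sup>+ x. g (x, x + \<epsilon> *\<^sub>R axis i 1) \<partial>count_space (lattice \<epsilon>))"
proof -
  define j :: "'n \<times> (real ^ 'n) \<Rightarrow> (real ^ 'n) \<times> (real ^ 'n)"
    where "j = (\<lambda>(i, x). (x, x + \<epsilon> *\<^sub>R axis i 1))"
  have "inj_on j (UNIV \<times> lattice \<epsilon>)"
    using assms by (auto simp: inj_on_def j_def axis_eq_axis)
  moreover have "j ` (UNIV \<times> lattice \<epsilon>) = grid_edges \<epsilon>"
    using assms by (auto simp: j_def grid_edges_eq image_iff)
  ultimately have j: "bij_betw j (UNIV \<times> lattice \<epsilon>) (grid_edges \<epsilon>)"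
    by (simp add: bij_betw_def)
  have "(\<integral>\<^sup>+ e. g e \<partial>count_space (grid_edges \<epsilon>)) = (\<integral>\<^sup>+ p. g (j p) \<partial>count_space (UNIV \<times> lattice \<epsilon>))"
    by (rule nn_integral_bij_count_space[OF j, symmetric])
  \<comment> \<open>Extension by zero to the whole type prepares for the iterated-sum rule of
    counting measures.\<close>
  also have "\<dots> = (\<integral>\<^sup>+ p. g (j p) * indicator (UNIV \<times> lattice \<epsilon>) p \<partial>count_space UNIV)"
    by (simp add: nn_integral_count_space_indicator)
  also have "\<dots> = (\<integral>\<^sup>+ i. \<integral>\<^sup>+ x. g (j (i, x)) * indicator (UNIV \<times> lattice \<epsilon>) (i, x)
      \<partial>count_space UNIV \<partial>count_space UNIV)"
    by (rule nn_integral_fst_count_space[symmetric])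
  also have "\<dots> = (\<integral>\<^sup>+ i. \<integral>\<^sup>+ x. g (j (i, x)) \<partial>count_space (lattice \<epsilon>) \<partial>count_space UNIV)"
    by (simp add: nn_integral_count_space_indicator indicator_times)
  also have "\<dots> = (\<Sum>i\<in>UNIV. \<integral>\<^sup>+ x. g (j (i, x)) \<partial>count_space (lattice \<epsilon>))"
    by (rule nn_integral_count_space_finite) simp
  finally show ?thesis by (simp add: j_def)
qed

text \<open>Each axis contributes one forward and one backward neighbour, and all of these are
  distinct, so the sum splits without overlap.\<close>

lemma sum_lattice_neighbours:
  fixes x :: "real ^ 'n" and g :: "real ^ 'n \<Rightarrow> real"
  assumes "\<epsilon> > 0" and x: "x \<in> lattice \<epsilon>"
  shows "(\<Sum>y | lattice_adj \<epsilon> x y. g y) =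
    (\<Sum>i\<in>UNIV. g (x + \<epsilon> *\<^sub>R axis i 1) + g (x - \<epsilon> *\<^sub>R axis i 1))"
proof -
  define P M where "P = (\<lambda>i::'n. x + \<epsilon> *\<^sub>R axis i 1)" and "M = (\<lambda>i::'n. x - \<epsilon> *\<^sub>R axis i 1)"
  have sym: "lattice_adj \<epsilon> x y" if "lattice_adj \<epsilon> y x" for y
    using that by (auto simp: lattice_adj_def abs_minus_commute)
  have "lattice_adj \<epsilon> x (P i)" for i
    using grid_edges_eq[of \<epsilon> x "P i"] assms by (auto simp: P_def grid_edges_def)
  moreover have "lattice_adj \<epsilon> x (M i)" for i
    using grid_edges_eq[of \<epsilon> "M i" x] assms lattice_translate(2)[OF x, of i]
    by (auto simp: M_def grid_edges_def intro: sym)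
  ultimately have "{y. lattice_adj \<epsilon> x y} = range P \<union> range M"
    using lattice_adj_imp_axis[OF assms(1)] by (fastforce simp: P_def M_def)
  \<comment> \<open>Coordinate \<open>i\<close> increases by \<open>\<epsilon>\<close> in
    \<open>P i\<close> but does not increase in \<open>M k\<close>.\<close>
  moreover have "P i \<noteq> M k" for i k
  proof
    assume "P i = M k"
    then have "P i $ i = M k $ i" by simp
    then show False using assms(1) by (auto simp: P_def M_def axis_def split: if_splits)
  qed
  then have "range P \<inter> range M = {}" by auto
  ultimately have "(\<Sum>y | lattice_adj \<epsilon> x y. g y) = (\<Sum>y\<in>range P. g y) + (\<Sum>y\<in>range M. g y)"
    by (simp add: sum.union_disjoint)
  moreover have "inj P" "inj M"
    using assms(1) by (auto simp: inj_on_def P_def M_def axis_eq_axis)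
  ultimately show ?thesis by (simp add: sum.reindex sum.distrib P_def M_def)
qed

text \<open>Every undirected edge occurs twice in the sum over ordered pairs; this cancels the factor
  \<open>1 / 2\<close>.\<close>

lemma grad_sqnorm_eq_sum_edges:
  fixes f :: "real ^ 'n \<Rightarrow> real"
  assumes "\<epsilon> > 0"
  shows "grad_sqnorm \<epsilon> f =
    (\<integral>\<^sup>+ e. ennreal ((f (snd e) - f (fst e))\<^sup>2 / \<epsilon>) \<partial>count_space (grid_edges \<epsilon>))"
proof -
  \<comment> \<open>\<open>a i x\<close> is the squared increment along the edge leaving
    \<open>x\<close> in direction \<open>i\<close>; a backward neighbour contributes the same
    quantity based at that neighbour.\<close>
  define a where "a = (\<lambda>(i::'n) x. ennreal ((f (x + \<epsilon> *\<^sub>R axis i 1) - f x)\<^sup>2))"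
  define S where "S = (\<Sum>i\<in>UNIV. \<integral>\<^sup>+ x. a i x \<partial>count_space (lattice \<epsilon>))"
  have "(\<integral>\<^sup>+ x. ennreal (\<Sum>y | lattice_adj \<epsilon> x y. \<bar>f y - f x\<bar>\<^sup>2) \<partial>count_space (lattice \<epsilon>)) =
    (\<integral>\<^sup>+ x. (\<Sum>i\<in>UNIV. a i x + a i (x - \<epsilon> *\<^sub>R axis i 1)) \<partial>count_space (lattice \<epsilon>))"
  proof (rule nn_integral_cong)
    fix x :: "real ^ 'n" assume "x \<in> space (count_space (lattice \<epsilon>))"
    then have "(\<Sum>y | lattice_adj \<epsilon> x y. \<bar>f y - f x\<bar>\<^sup>2) =
      (\<Sum>i\<in>UNIV. (f (x + \<epsilon> *\<^sub>R axis i 1) - f x)\<^sup>2 + (f x - f (x - \<epsilon> *\<^sub>R axis i 1))\<^sup>2)"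
      using sum_lattice_neighbours[OF assms, of x "\<lambda>y. \<bar>f y - f x\<bar>\<^sup>2"]
      by (simp add: power2_commute[of "f x"])
    then show "ennreal (\<Sum>y | lattice_adj \<epsilon> x y. \<bar>f y - f x\<bar>\<^sup>2) =
      (\<Sum>i\<in>UNIV. a i x + a i (x - \<epsilon> *\<^sub>R axis i 1))"
      by (simp add: a_def flip: ennreal_plus sum_ennreal)
  qed
  also have "\<dots> = (\<Sum>i\<in>UNIV. (\<integral>\<^sup>+ x. a i x \<partial>count_space (lattice \<epsilon>)) +
      (\<integral>\<^sup>+ x. a i (x - \<epsilon> *\<^sub>R axis i 1) \<partial>count_space (lattice \<epsilon>)))"
    by (subst nn_integral_sum) (auto simp: nn_integral_add)
  \<comment> \<open>Translation by one lattice step turns the backward sums into the forward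
    ones.\<close>
  also have "\<dots> = (\<Sum>i\<in>UNIV. 2 * (\<integral>\<^sup>+ x. a i x \<partial>count_space (lattice \<epsilon>)))"
  proof -
    have "(\<integral>\<^sup>+ x. a i (x - \<epsilon> *\<^sub>R axis i 1) \<partial>count_space (lattice \<epsilon>)) =
        (\<integral>\<^sup>+ x. a i x \<partial>count_space (lattice \<epsilon>))" for i
      using nn_integral_lattice_translate[where g = "\<lambda>x. a i (x - \<epsilon> *\<^sub>R axis i 1)"
          and \<epsilon> = \<epsilon> and i = i] by simp
    then show ?thesis by (simp add: mult_2)
  qed
  also have "\<dots> = 2 * S" by (simp add: S_def sum_distrib_left)
  finally have "grad_sqnorm \<epsilon> f = (ennreal (1 / (2 * \<epsilon>)) * ennreal 2) * S"
    by (simp add: grad_sqnorm_def mult.assoc)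
  also have "ennreal (1 / (2 * \<epsilon>)) * ennreal 2 = ennreal (1 / \<epsilon>)"
    using assms by (subst ennreal_mult''[symmetric]) simp_all
  also have "ennreal (1 / \<epsilon>) * S =
      (\<Sum>i\<in>UNIV. \<integral>\<^sup>+ x. ennreal (1 / \<epsilon>) * a i x \<partial>count_space (lattice \<epsilon>))"
    by (simp add: S_def sum_distrib_left nn_integral_cmult)
  also have "\<dots> = (\<integral>\<^sup>+ e. ennreal ((f (snd e) - f (fst e))\<^sup>2 / \<epsilon>) \<partial>count_space (grid_edges \<epsilon>))"
    unfolding nn_integral_grid_edges[OF assms] a_def using assms
    by (simp flip: ennreal_mult)
  finally show ?thesis .
qed

text \<open>Every vertex is the lower end of one edge per axis and the upper end of another, so its
  value is counted \<open>2 * CARD('n)\<close> times.\<close>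

lemma nn_integral_edge_ends:
  fixes f :: "real ^ 'n \<Rightarrow> real"
  assumes "\<epsilon> > 0"
  shows "(\<integral>\<^sup>+ e. ennreal ((f (fst e))\<^sup>2 + (f (snd e))\<^sup>2) \<partial>count_space (grid_edges \<epsilon>)) =
    ennreal (2 * real CARD('n)) * L2_sqnorm (count_space (lattice \<epsilon>)) f"
proof -
  have "(\<integral>\<^sup>+ x. ennreal ((f (fst (x, x + \<epsilon> *\<^sub>R axis i 1)))\<^sup>2 + (f (snd (x, x + \<epsilon> *\<^sub>R axis i 1)))\<^sup>2)
      \<partial>count_space (lattice \<epsilon>)) = 2 * L2_sqnorm (count_space (lattice \<epsilon>)) f" for i :: 'n
    using nn_integral_lattice_translate[where g = "\<lambda>x. ennreal ((f x)\<^sup>2)" and \<epsilon> = \<epsilon> and i = i]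
    by (simp add: L2_sqnorm_def nn_integral_add mult_2)
  then show ?thesis
    unfolding nn_integral_grid_edges[OF assms]
    by (simp add: ennreal_mult' ennreal_of_nat_eq_real_of_nat mult_ac)
qed

text \<open>The square of a difference is at most twice the sum of the squares, and
  \<open>nn_integral_edge_ends\<close> counts the endpoints. Consequently the lattice norm is
  equivalent to the l2 norm.\<close>

lemma grad_sqnorm_le:
  fixes f :: "real ^ 'n \<Rightarrow> real"
  assumes "\<epsilon> > 0"
  shows "grad_sqnorm \<epsilon> f \<le> ennreal (4 * real CARD('n) / \<epsilon>) * L2_sqnorm (count_space (lattice \<epsilon>)) f"
proof -
  have "grad_sqnorm \<epsilon> f \<le> (\<integral>\<^sup>+ e. ennreal (2 / \<epsilon>) * ennreal ((f (fst e))\<^sup>2 + (f (snd e))\<^sup>2)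
      \<partial>count_space (grid_edges \<epsilon>))"
    unfolding grad_sqnorm_eq_sum_edges[OF assms]
  proof (rule nn_integral_mono)
    fix e :: "(real ^ 'n) \<times> (real ^ 'n)"
    have "(f (snd e) - f (fst e))\<^sup>2 \<le> 2 * ((f (fst e))\<^sup>2 + (f (snd e))\<^sup>2)"
      using zero_le_power2[of "f (snd e) + f (fst e)"] by (simp add: power2_eq_square algebra_simps)
    then have "(f (snd e) - f (fst e))\<^sup>2 / \<epsilon> \<le> 2 / \<epsilon> * ((f (fst e))\<^sup>2 + (f (snd e))\<^sup>2)"
      using assms by (simp add: divide_simps)
    moreover have "0 \<le> (f (fst e))\<^sup>2 + (f (snd e))\<^sup>2" by simp
    ultimately show "ennreal ((f (snd e) - f (fst e))\<^sup>2 / \<epsilon>) \<le>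
        ennreal (2 / \<epsilon>) * ennreal ((f (fst e))\<^sup>2 + (f (snd e))\<^sup>2)"
      by (simp only: ennreal_leI ennreal_mult''[symmetric])
  qed
  also have "\<dots> = ennreal (2 / \<epsilon>) * (ennreal (2 * real CARD('n)) * L2_sqnorm (count_space (lattice \<epsilon>)) f)"
    by (simp add: nn_integral_cmult nn_integral_edge_ends[OF assms] del: ennreal_plus)
  also have "\<dots> = ennreal (4 * real CARD('n) / \<epsilon>) * L2_sqnorm (count_space (lattice \<epsilon>)) f"
    using assms by (simp add: mult_ac flip: mult.assoc ennreal_mult)
  finally show ?thesis .
qed

section \<open>\<open>H1_lattice\<close> as the space of square-summable functions\<close>

text \<open>A substitute for the triangle inequality that stays with squared norms and avoids square
  roots, at the price of a factor 2.\<close>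

lemma L2_sqnorm_add_le:
  assumes [measurable]: "f \<in> borel_measurable M" "g \<in> borel_measurable M"
  shows "L2_sqnorm M (\<lambda>x. f x + g x) \<le> 2 * (L2_sqnorm M f + L2_sqnorm M g)"
proof -
  have "L2_sqnorm M (\<lambda>x. f x + g x) \<le> (\<integral>\<^sup>+ x. 2 * (ennreal ((f x)\<^sup>2) + ennreal ((g x)\<^sup>2)) \<partial>M)"
    unfolding L2_sqnorm_def
  proof (rule nn_integral_mono)
    fix x
    have "(f x + g x)\<^sup>2 \<le> 2 * ((f x)\<^sup>2 + (g x)\<^sup>2)"
      using zero_le_power2[of "f x - g x"] by (simp add: power2_eq_square algebra_simps)
    then have "ennreal ((f x + g x)\<^sup>2) \<le> ennreal (2 * ((f x)\<^sup>2 + (g x)\<^sup>2))" by (rule ennreal_leI)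
    then show "ennreal ((f x + g x)\<^sup>2) \<le> 2 * (ennreal ((f x)\<^sup>2) + ennreal ((g x)\<^sup>2))"
      by (simp add: ennreal_mult')
  qed
  also have "\<dots> = 2 * (L2_sqnorm M f + L2_sqnorm M g)"
    by (simp add: L2_sqnorm_def nn_integral_cmult nn_integral_add)
  finally show ?thesis .
qed

lemma L2_sqnorm_diff_le:
  assumes "f \<in> borel_measurable M" "g \<in> borel_measurable M"
  shows "L2_sqnorm M (\<lambda>x. f x - g x) \<le> 2 * (L2_sqnorm M f + L2_sqnorm M g)"
  using L2_sqnorm_add_le[of f M "\<lambda>x. - g x"] assms by (simp add: L2_sqnorm_def)

text \<open>A Cauchy sequence is bounded in l2 by comparison with one finitely supported member;
  Fatou's lemma passes the bound to the pointwise limit.\<close>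

lemma H1_lattice_imp_L2:
  fixes f :: "real ^ 'n \<Rightarrow> real"
  assumes "f \<in> H1_lattice \<epsilon>"
  shows "L2_sqnorm (count_space (lattice \<epsilon>)) f < \<infinity>"
proof -
  let ?M = "count_space (lattice \<epsilon>) :: (real ^ 'n) measure"
  obtain F :: "nat \<Rightarrow> real ^ 'n \<Rightarrow> real" where
    fin: "\<And>n. finite {x \<in> lattice \<epsilon>. F n x \<noteq> 0}" and
    cauchy: "\<And>\<delta>. \<delta> > 0 \<Longrightarrow> \<exists>N. \<forall>m\<ge>N. \<forall>n\<ge>N. lattice_H1_sqnorm \<epsilon> (\<lambda>x. F m x - F n x) < ennreal (\<delta>\<^sup>2)" and
    lim: "\<And>x. x \<in> lattice \<epsilon> \<Longrightarrow> (\<lambda>n. F n x) \<longlonglongrightarrow> f x"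
    using assms unfolding H1_lattice_def by blast
  obtain N where N: "\<And>n. n \<ge> N \<Longrightarrow> lattice_H1_sqnorm \<epsilon> (\<lambda>x. F n x - F N x) < 1"
    using cauchy[of 1] by auto
  define B where "B = 2 * (1 + L2_sqnorm ?M (F N))"
  have "L2_sqnorm ?M (F N) = (\<Sum>x | x \<in> lattice \<epsilon> \<and> F N x \<noteq> 0. ennreal ((F N x)\<^sup>2))"
    unfolding L2_sqnorm_def by (rule nn_integral_count_space'[OF fin]) auto
  then have B: "B < \<infinity>" by (simp add: B_def ennreal_mult_less_top)
  have bound: "L2_sqnorm ?M (F n) \<le> B" if "n \<ge> N" for n
  proof -
    have "L2_sqnorm ?M (F n) \<le> 2 * (L2_sqnorm ?M (\<lambda>x. F n x - F N x) + L2_sqnorm ?M (F N))"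
      using L2_sqnorm_add_le[of "\<lambda>x. F n x - F N x" ?M "F N"] by simp
    also have "L2_sqnorm ?M (\<lambda>x. F n x - F N x) \<le> lattice_H1_sqnorm \<epsilon> (\<lambda>x. F n x - F N x)"
      by (simp add: lattice_H1_sqnorm_def)
    also have "\<dots> \<le> 1" using N[OF that] by simp
    finally show ?thesis by (simp add: B_def mult_left_mono add_right_mono)
  qed
  have "L2_sqnorm ?M f = (\<integral>\<^sup>+ x. liminf (\<lambda>n. ennreal ((F n x)\<^sup>2)) \<partial>?M)"
    unfolding L2_sqnorm_def
  proof (rule nn_integral_cong)
    fix x assume "x \<in> space ?M"
    then have "(\<lambda>n. ennreal ((F n x)\<^sup>2)) \<longlonglongrightarrow> ennreal ((f x)\<^sup>2)"
      by (intro tendsto_ennrealI tendsto_power lim) simp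
    then show "ennreal ((f x)\<^sup>2) = liminf (\<lambda>n. ennreal ((F n x)\<^sup>2))"
      by (rule lim_imp_Liminf[OF sequentially_bot, symmetric])
  qed
  also have "\<dots> \<le> liminf (\<lambda>n. L2_sqnorm ?M (F n))"
    unfolding L2_sqnorm_def by (rule nn_integral_liminf) simp
  also have "\<dots> \<le> B"
    by (rule Liminf_le) (use bound in \<open>auto simp: eventually_sequentially\<close>)
  finally show ?thesis using B by (rule le_less_trans)
qed

text \<open>Truncations to growing balls are finitely supported and converge pointwise. Their l2
  tails tend to 0 by dominated convergence, and \<open>grad_sqnorm_le\<close> makes them Cauchy in
  the full norm.\<close>

lemma L2_imp_H1_lattice:
  fixes f :: "real ^ 'n \<Rightarrow> real"
  assumes "\<epsilon> > 0" and f: "L2_sqnorm (count_space (lattice \<epsilon>)) f < \<infinity>"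
  shows "f \<in> H1_lattice \<epsilon>"
proof -
  let ?M = "count_space (lattice \<epsilon>) :: (real ^ 'n) measure"
  define F where "F = (\<lambda>(n::nat) x. if norm x \<le> real n then f x else 0)"
  define T where "T = (\<lambda>n. L2_sqnorm ?M (\<lambda>x. f x - F n x))"
  \<comment> \<open>The outer 2 comes from \<open>L2_sqnorm_diff_le\<close>; inside, the first
    summand pays for the gradient and the 1 for the l2 part.\<close>
  define C where "C = 2 * (4 * real CARD('n) / \<epsilon> + 1)"
  have C: "C > 0" using assms by (auto simp: C_def intro!: add_nonneg_pos)
  have F: "\<forall>\<^sub>F n in sequentially. F n x = f x" for x
    using eventually_ge_at_top[of "nat \<lceil>norm x\<rceil>"]
    by eventually_elim (auto simp: F_def nat_le_iff ceiling_le_iff)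
  have "T \<longlonglongrightarrow> (\<integral>\<^sup>+ x. 0 \<partial>?M)"
    unfolding T_def L2_sqnorm_def
  proof (rule nn_integral_dominated_convergence)
    show "(\<integral>\<^sup>+ x. ennreal ((f x)\<^sup>2) \<partial>?M) < \<infinity>" using f by (simp add: L2_sqnorm_def)
    have "(\<lambda>n. ennreal ((f x - F n x)\<^sup>2)) \<longlonglongrightarrow> 0" for x
      by (rule tendsto_eventually) (use F[of x] in \<open>eventually_elim, simp\<close>)
    then show "AE x in ?M. (\<lambda>n. ennreal ((f x - F n x)\<^sup>2)) \<longlonglongrightarrow> 0" by simp
  qed (auto simp: F_def)
  then have T: "T \<longlonglongrightarrow> 0" by simp
  have H: "lattice_H1_sqnorm \<epsilon> (\<lambda>x. F m x - F n x) \<le> ennreal C * (T n + T m)" for m n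
  proof -
    have "L2_sqnorm ?M (\<lambda>x. F m x - F n x) \<le> 2 * (T n + T m)"
      \<comment> \<open>Here \<open>F m x - F n x\<close> is read as
        \<open>(f x - F n x) - (f x - F m x)\<close>.\<close>
      using L2_sqnorm_diff_le[of "\<lambda>x. f x - F n x" ?M "\<lambda>x. f x - F m x"] by (simp add: T_def)
    then have "lattice_H1_sqnorm \<epsilon> (\<lambda>x. F m x - F n x) \<le>
        ennreal (4 * real CARD('n) / \<epsilon>) * (2 * (T n + T m)) + 2 * (T n + T m)"
      unfolding lattice_H1_sqnorm_def
      by (intro add_mono order_trans[OF grad_sqnorm_le[OF assms(1)]] mult_left_mono) auto
    also have "\<dots> = (ennreal (4 * real CARD('n) / \<epsilon>) + 1) * 2 * (T n + T m)"
      by (simp add: distrib_right mult.assoc)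
    also have "(ennreal A + 1) * 2 = ennreal (2 * (A + 1))" if "A \<ge> 0" for A
      using that by (simp add: ennreal_mult' mult.commute)
    then have "(ennreal (4 * real CARD('n) / \<epsilon>) + 1) * 2 = ennreal C"
      using assms(1) by (simp only: C_def) simp
    finally show ?thesis .
  qed
  show ?thesis unfolding H1_lattice_def mem_Collect_eq
  proof (intro exI[of _ F] conjI allI impI ballI)
    fix n show "finite {x \<in> lattice \<epsilon>. F n x \<noteq> 0}"
      by (rule finite_subset[OF _ finite_lattice_norm_le[OF assms(1), of "real n"]])
         (auto simp: F_def split: if_splits)
  next
    fix x show "(\<lambda>n. F n x) \<longlonglongrightarrow> f x" using F[of x] by (rule tendsto_eventually)
  next
    fix \<delta> :: real assume "\<delta> > 0"
    \<comment> \<open>With this choice \<open>C * (r + r)\<close> is half of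
      \<open>\<delta>\<^sup>2\<close>.\<close>
    define r where "r = \<delta>\<^sup>2 / (4 * C)"
    have r: "r > 0" "C * (r + r) < \<delta>\<^sup>2" using C \<open>\<delta> > 0\<close> by (auto simp: r_def)
    have "\<forall>\<^sub>F n in sequentially. T n < ennreal r"
      using r(1) by (intro order_tendstoD(2)[OF T]) simp
    then obtain N where N: "\<And>n. n \<ge> N \<Longrightarrow> T n < ennreal r" by (auto simp: eventually_sequentially)
    have "lattice_H1_sqnorm \<epsilon> (\<lambda>x. F m x - F n x) < ennreal (\<delta>\<^sup>2)" if "m \<ge> N" "n \<ge> N" for m n
    proof -
      have "lattice_H1_sqnorm \<epsilon> (\<lambda>x. F m x - F n x) \<le> ennreal C * (ennreal r + ennreal r)"
        using N that by (intro order_trans[OF H] mult_left_mono add_mono) (auto simp: less_imp_le)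
      also have "\<dots> = ennreal (C * (r + r))" using C r by (simp only: ennreal_mult ennreal_plus less_imp_le add_nonneg_nonneg)
      also have "\<dots> < ennreal (\<delta>\<^sup>2)" using r \<open>\<delta> > 0\<close> by (intro ennreal_lessI) auto
      finally show ?thesis .
    qed
    then show "\<exists>N. \<forall>m\<ge>N. \<forall>n\<ge>N. lattice_H1_sqnorm \<epsilon> (\<lambda>x. F m x - F n x) < ennreal (\<delta>\<^sup>2)" by blast
  qed
qed


subsection \<open>The metric grid\<close>


lemma edge_point_in_metric_grid:
  "e \<in> grid_edges \<epsilon> \<Longrightarrow> s \<in> {0..\<epsilon>} \<Longrightarrow> edge_point \<epsilon> e s \<in> metric_grid \<epsilon>"
  unfolding metric_grid_def by blast

lemma edge_point_ends:
  assumes "\<epsilon> > 0"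
  shows "edge_point \<epsilon> e 0 = fst e" "edge_point \<epsilon> e \<epsilon> = snd e"
  using assms by (auto simp: edge_point_def)

lemma continuous_on_edge_point: "continuous_on S (edge_point \<epsilon> e)"
  unfolding edge_point_def divide_inverse by (intro continuous_intros)

lemma continuous_on_edge_fun:
  assumes "continuous_on (metric_grid \<epsilon>) u" "e \<in> grid_edges \<epsilon>"
  shows "continuous_on {0..\<epsilon>} (edge_fun \<epsilon> u e)"
  unfolding edge_fun_def
  by (rule continuous_on_compose2[OF assms(1) continuous_on_edge_point])
     (use assms(2) in \<open>auto intro: edge_point_in_metric_grid\<close>)

lemma grid_edges_ends_in_lattice:
  assumes "e \<in> grid_edges \<epsilon>"
  shows "fst e \<in> lattice \<epsilon>" "snd e \<in> lattice \<epsilon>"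
  using assms by (auto simp: grid_edges_def lattice_adj_def)

lemma norm_grid_edge:
  fixes e :: "(real ^ 'n) \<times> (real ^ 'n)"
  assumes "\<epsilon> > 0" "e \<in> grid_edges \<epsilon>"
  shows "norm (snd e - fst e) = \<epsilon>"
proof -
  obtain x y where e: "e = (x, y)" by (cases e)
  then obtain i where "y = x + \<epsilon> *\<^sub>R axis i 1" using assms by (auto simp: grid_edges_eq)
  then show ?thesis using assms(1) by (simp add: e norm_axis_1)
qed

lemma affine_extension_spec:
  fixes f :: "real ^ 'n \<Rightarrow> real"
  assumes "\<epsilon> > 0"
  shows "is_affine_extension \<epsilon> f (affine_extension \<epsilon> f)"
  using theI'[OF affine_extension_ex1[OF assms, of f]] by (simp add: affine_extension_def)

lemma affine_extension_edge:
  fixes f :: "real ^ 'n \<Rightarrow> real"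
  assumes "\<epsilon> > 0" and e: "e \<in> grid_edges \<epsilon>" and s: "s \<in> {0..\<epsilon>}"
  shows "affine_extension \<epsilon> f (edge_point \<epsilon> e s) = f (fst e) + (f (snd e) - f (fst e)) / \<epsilon> * s"
proof -
  note A = affine_extension_spec[OF assms(1), of f, unfolded is_affine_extension_def]
  obtain a b where ab: "\<And>s. s \<in> {0..\<epsilon>} \<Longrightarrow> affine_extension \<epsilon> f (edge_point \<epsilon> e s) = a + b * s"
    using A e by blast
  have "f (fst e) = a" "f (snd e) = a + b * \<epsilon>"
    using ab[of 0] ab[of \<epsilon>] A grid_edges_ends_in_lattice[OF e] assms(1)
    by (simp_all add: edge_point_ends)
  then show ?thesis using ab[OF s] assms(1) by simp
qed

text \<open>If an edge meets the unit ball around \<open>z\<close>, its lower endpoint has norm at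
  most \<open>norm z + 1 + \<epsilon>\<close>. Only finitely many lattice points qualify, each with
  finitely many directions.\<close>

lemma grid_edges_locally_finite:
  assumes "\<epsilon> > 0"
  shows "finite {e \<in> grid_edges \<epsilon> :: ((real ^ 'n) \<times> (real ^ 'n)) set.
    edge_point \<epsilon> e ` {0..\<epsilon>} \<inter> ball z 1 \<noteq> {}}" (is "finite ?E")
proof (rule finite_subset)
  let ?B = "{x \<in> lattice \<epsilon>. norm x \<le> norm z + 1 + \<epsilon>}"
  show "finite ((\<lambda>(x, i). (x, x + \<epsilon> *\<^sub>R axis i 1)) ` (?B \<times> (UNIV :: 'n set)))"
    by (intro finite_imageI finite_cartesian_product finite_lattice_norm_le[OF assms] finite)
  show "?E \<subseteq> (\<lambda>(x, i). (x, x + \<epsilon> *\<^sub>R axis i 1)) ` (?B \<times> UNIV)"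
  proof
    fix e assume "e \<in> ?E"
    then obtain s where e: "e \<in> grid_edges \<epsilon>" and s: "s \<in> {0..\<epsilon>}" "edge_point \<epsilon> e s \<in> ball z 1"
      by blast
    obtain x y where xy: "e = (x, y)" by (cases e)
    then obtain i where x: "x \<in> lattice \<epsilon>" and i: "y = x + \<epsilon> *\<^sub>R axis i 1"
      using e assms by (auto simp: grid_edges_eq)
    define w where "w = edge_point \<epsilon> e s"
    have "w - x = (s / \<epsilon>) *\<^sub>R (y - x)" by (simp add: w_def edge_point_def xy)
    then have "norm (w - x) = s"
      using norm_grid_edge[OF assms e] s assms by (simp add: xy)
    moreover have "norm (w - z) < 1"
      using s(2) by (simp add: w_def dist_norm norm_minus_commute)
    moreover have "norm x \<le> norm (w - x) + norm w" "norm w \<le> norm (w - z) + norm z"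
      using norm_triangle_ineq4[of w "w - x"] norm_triangle_ineq[of "w - z" z] by simp_all
    ultimately have "norm x \<le> norm z + 1 + \<epsilon>" using s(1) by simp
    then show "e \<in> (\<lambda>(x, i). (x, x + \<epsilon> *\<^sub>R axis i 1)) ` (?B \<times> UNIV)"
      using x i xy by auto
  qed
qed

text \<open>The edges form a locally finite closed cover of the grid, and on each of them \<open>g\<close> is a
  continuous function of the arc length \<open>(z - x) \<bullet> (y - x) / \<epsilon>\<close>.\<close>

lemma continuous_on_metric_grid_edgewise:
  fixes g :: "real ^ 'n \<Rightarrow> real"
  assumes "\<epsilon> > 0" and g: "\<And>e. e \<in> grid_edges \<epsilon> \<Longrightarrow> continuous_on {0..\<epsilon>} (edge_fun \<epsilon> g e)"
  shows "continuous_on (metric_grid \<epsilon>) g"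
proof -
  let ?X = "top_of_set (metric_grid \<epsilon> :: (real ^ 'n) set)"
  let ?T = "\<lambda>e :: (real ^ 'n) \<times> (real ^ 'n). edge_point \<epsilon> e ` {0..\<epsilon>}"
  have sub: "?T e \<subseteq> metric_grid \<epsilon>" if "e \<in> grid_edges \<epsilon>" for e
    using that by (auto intro: edge_point_in_metric_grid)
  have "continuous_map ?X euclideanreal g"
  proof (rule pasting_lemma_locally_finite[where I = "grid_edges \<epsilon>" and T = ?T and f = "\<lambda>_. g"])
    fix x assume x: "x \<in> topspace ?X"
    have "finite {e \<in> grid_edges \<epsilon>. ?T e \<inter> (metric_grid \<epsilon> \<inter> ball x 1) \<noteq> {}}"
      by (rule finite_subset[OF _ grid_edges_locally_finite[OF assms(1), of x]]) auto
    then show "\<exists>V. openin ?X V \<and> x \<in> V \<and> finite {e \<in> grid_edges \<epsilon>. ?T e \<inter> V \<noteq> {}}"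
      using x by (intro exI[of _ "metric_grid \<epsilon> \<inter> ball x 1"]) auto
    show "\<exists>j. j \<in> grid_edges \<epsilon> \<and> x \<in> ?T j \<and> g x = g x"
      using x by (auto simp: metric_grid_def)
  next
    fix e :: "(real ^ 'n) \<times> (real ^ 'n)" assume e: "e \<in> grid_edges \<epsilon>"
    have "compact (?T e)"
      by (intro compact_continuous_image continuous_on_edge_point) simp
    then show "closedin ?X (?T e)"
      by (intro closed_subset sub e compact_imp_closed)
    define \<sigma> where "\<sigma> = (\<lambda>z. (z - fst e) \<bullet> (snd e - fst e) / \<epsilon>)"
    \<comment> \<open>The edge vector has length \<open>\<epsilon>\<close>, so the inner product is
      \<open>s * \<epsilon>\<close> and the division leaves \<open>s\<close>.\<close>
    have \<sigma>: "\<sigma> (edge_point \<epsilon> e s) = s" for s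
      using norm_grid_edge[OF assms(1) e] assms(1)
      by (simp add: \<sigma>_def edge_point_def dot_square_norm power2_eq_square)
    have "continuous_on (?T e) (\<lambda>z. edge_fun \<epsilon> g e (\<sigma> z))"
    proof (rule continuous_on_compose2[OF g[OF e]])
      show "continuous_on (?T e) \<sigma>"
        unfolding \<sigma>_def divide_inverse by (intro continuous_intros)
    qed (auto simp: \<sigma>)
    then have "continuous_on (?T e) g"
      by (rule continuous_on_eq) (auto simp: \<sigma> edge_fun_def)
    then show "continuous_map (subtopology ?X (?T e)) euclideanreal g"
      using sub[OF e] by (simp add: subtopology_subtopology inf.absorb2)
  qed auto
  then show ?thesis by simp
qed

section \<open>Restriction to the vertices\<close>

text \<open>With both sides written as sums over edges, \<open>H1_interval_jump_bound\<close>
  compares them term by term.\<close>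

lemma grad_sqnorm_vertex_restriction_le:
  fixes u :: "real ^ 'n \<Rightarrow> real"
  assumes "\<epsilon> > 0" and u: "u \<in> H1_grid \<epsilon>"
  shows "grad_sqnorm \<epsilon> (vertex_restriction \<epsilon> u) \<le> grid_deriv_sqnorm \<epsilon> u"
  unfolding grad_sqnorm_eq_sum_edges[OF assms(1)] grid_deriv_sqnorm_def
proof (rule nn_integral_mono)
  fix e :: "(real ^ 'n) \<times> (real ^ 'n)" assume "e \<in> space (count_space (grid_edges \<epsilon>))"
  then have e: "e \<in> grid_edges \<epsilon>" by simp
  have "continuous_on {0..\<epsilon>} (edge_fun \<epsilon> u e)" "edge_fun \<epsilon> u e \<in> H1_interval 0 \<epsilon>"
    using u e continuous_on_edge_fun[OF _ e, of u] by (auto simp: H1_grid_def)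
  from H1_interval_jump_bound[OF assms(1) this(2,1)]
  show "ennreal ((vertex_restriction \<epsilon> u (snd e) - vertex_restriction \<epsilon> u (fst e))\<^sup>2 / \<epsilon>) \<le>
      L2_sqnorm (lebesgue_on {0..\<epsilon>}) (weak_deriv 0 \<epsilon> (edge_fun \<epsilon> u e))"
    using grid_edges_ends_in_lattice[OF e] assms(1)
    by (simp add: vertex_restriction_def edge_fun_def edge_point_ends)
qed

text \<open>By \<open>L2_imp_H1_lattice\<close> square-summability suffices. The trace bound on one
  outgoing edge per vertex controls each vertex value.\<close>

lemma vertex_restriction_in_H1_lattice:
  fixes u :: "real ^ 'n \<Rightarrow> real"
  assumes "\<epsilon> > 0" and u: "u \<in> H1_grid \<epsilon>"
  shows "vertex_restriction \<epsilon> u \<in> H1_lattice \<epsilon>"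
proof (rule L2_imp_H1_lattice[OF assms(1)])
  let ?b = "\<lambda>e. ennreal (2 / \<epsilon>) * L2_sqnorm (lebesgue_on {0..\<epsilon>}) (edge_fun \<epsilon> u e) +
     ennreal (2 * \<epsilon>) * L2_sqnorm (lebesgue_on {0..\<epsilon>}) (weak_deriv 0 \<epsilon> (edge_fun \<epsilon> u e))"
  \<comment> \<open>Any fixed axis will do; it selects one outgoing edge at every vertex.\<close>
  define i :: 'n where "i = undefined"
  have "L2_sqnorm (count_space (lattice \<epsilon>)) (vertex_restriction \<epsilon> u) \<le>
      (\<integral>\<^sup>+ x. ?b (x, x + \<epsilon> *\<^sub>R axis i 1) \<partial>count_space (lattice \<epsilon>))"
    unfolding L2_sqnorm_def[of "count_space _"]
  proof (rule nn_integral_mono)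
    fix x :: "real ^ 'n" assume "x \<in> space (count_space (lattice \<epsilon>))"
    then have x: "x \<in> lattice \<epsilon>" by simp
    let ?e = "(x, x + \<epsilon> *\<^sub>R axis i 1)"
    have e: "?e \<in> grid_edges \<epsilon>" using x assms(1) by (auto simp: grid_edges_eq)
    have "continuous_on {0..\<epsilon>} (edge_fun \<epsilon> u ?e)" "edge_fun \<epsilon> u ?e \<in> H1_interval 0 \<epsilon>"
      using u e continuous_on_edge_fun[OF _ e, of u] by (auto simp: H1_grid_def)
    from H1_interval_trace_bound[OF assms(1) this(2,1)]
    show "ennreal ((vertex_restriction \<epsilon> u x)\<^sup>2) \<le> ?b ?e"
      using x by (simp add: vertex_restriction_def edge_fun_def edge_point_ends[OF assms(1)])
  qed
  \<comment> \<open>Adding the nonnegative sums over the other axes completes the sum over all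
    edges.\<close>
  also have "\<dots> \<le> (\<Sum>i\<in>UNIV. \<integral>\<^sup>+ x. ?b (x, x + \<epsilon> *\<^sub>R axis i 1) \<partial>count_space (lattice \<epsilon>))"
    by (rule member_le_sum) auto
  also have "\<dots> = (\<integral>\<^sup>+ e. ?b e \<partial>count_space (grid_edges \<epsilon>))"
    by (rule nn_integral_grid_edges[OF assms(1), symmetric])
  also have "\<dots> = ennreal (2 / \<epsilon>) * grid_sqnorm \<epsilon> u + ennreal (2 * \<epsilon>) * grid_deriv_sqnorm \<epsilon> u"
    by (simp add: grid_sqnorm_def grid_deriv_sqnorm_def nn_integral_add nn_integral_cmult)
  also have "\<dots> < \<infinity>"
    using u by (auto simp: H1_grid_def ennreal_mult_less_top)
  finally show "L2_sqnorm (count_space (lattice \<epsilon>)) (vertex_restriction \<epsilon> u) < \<infinity>" .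
qed

section \<open>Affine extension from the vertices\<close>

text \<open>The slope on an edge is the increment divided by \<open>\<epsilon>\<close>, so the edge
  energies agree. Infinite values are allowed, so the identity can itself supply finiteness in the
  proof that the extension lies in \<open>H1_grid\<close>.\<close>

lemma grid_deriv_sqnorm_affine_extension:
  fixes f :: "real ^ 'n \<Rightarrow> real"
  assumes "\<epsilon> > 0"
  shows "grid_deriv_sqnorm \<epsilon> (affine_extension \<epsilon> f) = grad_sqnorm \<epsilon> f"
  unfolding grad_sqnorm_eq_sum_edges[OF assms] grid_deriv_sqnorm_def
proof (rule nn_integral_cong)
  fix e :: "(real ^ 'n) \<times> (real ^ 'n)" assume "e \<in> space (count_space (grid_edges \<epsilon>))"
  then have e: "e \<in> grid_edges \<epsilon>" by simp
  have "L2_sqnorm (lebesgue_on {0..\<epsilon>}) (weak_deriv 0 \<epsilon> (edge_fun \<epsilon> (affine_extension \<epsilon> f) e)) =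
      ennreal ((\<epsilon> - 0) * ((f (snd e) - f (fst e)) / \<epsilon>)\<^sup>2)"
    by (rule affine_H1_interval(2)[OF assms])
       (unfold edge_fun_def, rule affine_extension_edge[OF assms e])
  also have "(\<epsilon> - 0) * ((f (snd e) - f (fst e)) / \<epsilon>)\<^sup>2 = (f (snd e) - f (fst e))\<^sup>2 / \<epsilon>"
    using assms by (simp add: power2_eq_square)
  finally show "L2_sqnorm (lebesgue_on {0..\<epsilon>}) (weak_deriv 0 \<epsilon> (edge_fun \<epsilon> (affine_extension \<epsilon> f) e)) =
      ennreal ((f (snd e) - f (fst e))\<^sup>2 / \<epsilon>)" .
qed

text \<open>On an edge the extension is a convex combination of the end values, so its square is at
  most the sum of their squares. Integration contributes the length \<open>\<epsilon>\<close>, and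
  counting endpoints contributes the remaining factor.\<close>

lemma grid_sqnorm_affine_extension_le:
  fixes f :: "real ^ 'n \<Rightarrow> real"
  assumes "\<epsilon> > 0"
  shows "grid_sqnorm \<epsilon> (affine_extension \<epsilon> f) \<le>
    ennreal \<epsilon> * (ennreal (2 * real CARD('n)) * L2_sqnorm (count_space (lattice \<epsilon>)) f)"
proof -
  have "grid_sqnorm \<epsilon> (affine_extension \<epsilon> f) \<le>
      (\<integral>\<^sup>+ e. ennreal \<epsilon> * ennreal ((f (fst e))\<^sup>2 + (f (snd e))\<^sup>2) \<partial>count_space (grid_edges \<epsilon>))"
    unfolding grid_sqnorm_def
  proof (rule nn_integral_mono)
    fix e :: "(real ^ 'n) \<times> (real ^ 'n)" assume "e \<in> space (count_space (grid_edges \<epsilon>))"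
    then have e: "e \<in> grid_edges \<epsilon>" by simp
    define p q where "p = f (fst e)" and "q = f (snd e)"
    have "L2_sqnorm (lebesgue_on {0..\<epsilon>}) (edge_fun \<epsilon> (affine_extension \<epsilon> f) e) \<le>
        (\<integral>\<^sup>+ s. ennreal (p\<^sup>2 + q\<^sup>2) \<partial>lebesgue_on {0..\<epsilon>})"
      unfolding L2_sqnorm_def
    proof (rule nn_integral_mono)
      fix s assume "s \<in> space (lebesgue_on {0..\<epsilon>})"
      then have s: "s \<in> {0..\<epsilon>}" by simp
      define t where "t = s / \<epsilon>"
      have t: "0 \<le> t" "t \<le> 1" using s assms by (auto simp: t_def)
      have v: "edge_fun \<epsilon> (affine_extension \<epsilon> f) e s = (1 - t) * p + t * q"
        unfolding edge_fun_def affine_extension_edge[OF assms e s]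
        by (simp add: p_def q_def t_def algebra_simps diff_divide_distrib)
      have "(edge_fun \<epsilon> (affine_extension \<epsilon> f) e s)\<^sup>2 \<le> (1 - t) * p\<^sup>2 + t * q\<^sup>2"
      proof -
        \<comment> \<open>This identity is the explicit convexity defect of the square
          function.\<close>
        have "(1 - t) * p\<^sup>2 + t * q\<^sup>2 - ((1 - t) * p + t * q)\<^sup>2 = t * (1 - t) * (p - q)\<^sup>2"
          by (simp add: power2_eq_square algebra_simps)
        moreover have "\<dots> \<ge> 0" using t by simp
        ultimately show ?thesis unfolding v by linarith
      qed
      also have "\<dots> \<le> p\<^sup>2 + q\<^sup>2"
        using t by (intro add_mono) (auto intro: mult_left_le_one_le)
      finally show "ennreal ((edge_fun \<epsilon> (affine_extension \<epsilon> f) e s)\<^sup>2) \<le> ennreal (p\<^sup>2 + q\<^sup>2)"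
        by (rule ennreal_leI)
    qed
    also have "\<dots> = ennreal \<epsilon> * ennreal (p\<^sup>2 + q\<^sup>2)"
      using assms by (simp add: emeasure_restrict_space mult.commute)
    finally show "L2_sqnorm (lebesgue_on {0..\<epsilon>}) (edge_fun \<epsilon> (affine_extension \<epsilon> f) e) \<le>
        ennreal \<epsilon> * ennreal ((f (fst e))\<^sup>2 + (f (snd e))\<^sup>2)"
      by (simp add: p_def q_def)
  qed
  also have "\<dots> = ennreal \<epsilon> * (ennreal (2 * real CARD('n)) * L2_sqnorm (count_space (lattice \<epsilon>)) f)"
    by (simp add: nn_integral_cmult nn_integral_edge_ends[OF assms] del: ennreal_plus)
  finally show ?thesis .
qed

text \<open>Continuity is glued from the edges. Both norms are finite because each is bounded by a
  multiple of the l2 norm of \<open>f\<close>, which \<open>H1_lattice_imp_L2\<close> makes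
  finite.\<close>

lemma affine_extension_in_H1_grid:
  fixes f :: "real ^ 'n \<Rightarrow> real"
  assumes "\<epsilon> > 0" and f: "f \<in> H1_lattice \<epsilon>"
  shows "affine_extension \<epsilon> f \<in> H1_grid \<epsilon>"
proof -
  let ?g = "affine_extension \<epsilon> f"
  have edge: "edge_fun \<epsilon> ?g e s = f (fst e) + (f (snd e) - f (fst e)) / \<epsilon> * s"
    if "e \<in> grid_edges \<epsilon>" "s \<in> {0..\<epsilon>}" for e s
    using affine_extension_edge[OF assms(1) that] by (simp add: edge_fun_def)
  have "continuous_on {0..\<epsilon>} (edge_fun \<epsilon> ?g e)" if "e \<in> grid_edges \<epsilon>" for e
    by (rule continuous_on_eq[of _ "\<lambda>s. f (fst e) + (f (snd e) - f (fst e)) / \<epsilon> * s"])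
       (use edge[OF that] assms(1) in \<open>auto intro!: continuous_intros\<close>)
  then have "continuous_on (metric_grid \<epsilon>) ?g"
    by (rule continuous_on_metric_grid_edgewise[OF assms(1)])
  moreover have "edge_fun \<epsilon> ?g e \<in> H1_interval 0 \<epsilon>" if "e \<in> grid_edges \<epsilon>" for e
    by (rule affine_H1_interval(1)[OF assms(1) edge[OF that]])
  moreover have "grid_deriv_sqnorm \<epsilon> ?g < \<infinity>"
    unfolding grid_deriv_sqnorm_affine_extension[OF assms(1)]
    by (rule le_less_trans[OF grad_sqnorm_le[OF assms(1)]])
       (use H1_lattice_imp_L2[OF f] in \<open>simp add: ennreal_mult_less_top\<close>)
  moreover have "grid_sqnorm \<epsilon> ?g < \<infinity>"
    by (rule le_less_trans[OF grid_sqnorm_affine_extension_le[OF assms(1)]])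
       (use H1_lattice_imp_L2[OF f] in \<open>simp add: ennreal_mult_less_top\<close>)
  ultimately show ?thesis by (simp add: H1_grid_def)
qed

theorem lemma2p3:
  fixes \<epsilon> :: real
  assumes "\<epsilon> > 0"
  shows "(\<forall>u :: real ^ 'n \<Rightarrow> real. u \<in> H1_grid \<epsilon> \<longrightarrow>
            vertex_restriction \<epsilon> u \<in> H1_lattice \<epsilon> \<and>
            grad_sqnorm \<epsilon> (vertex_restriction \<epsilon> u) \<le> grid_deriv_sqnorm \<epsilon> u) \<and>
         (\<forall>f :: real ^ 'n \<Rightarrow> real. f \<in> H1_lattice \<epsilon> \<longrightarrow>
            affine_extension \<epsilon> f \<in> H1_grid \<epsilon> \<and>
            grid_deriv_sqnorm \<epsilon> (affine_extension \<epsilon> f) = grad_sqnorm \<epsilon> f)"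
  using assms vertex_restriction_in_H1_lattice grad_sqnorm_vertex_restriction_le
    affine_extension_in_H1_grid grid_deriv_sqnorm_affine_extension by blast

end
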